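(* Consider a sequence, indexed by $N\geq 1$, of Biorthogonal Ensembles satisfying the structural assumption (both described in the context). Assume there exists $\varepsilon>0$ such that for every integer $n\geq 1$, $$\max_{k,m\in\mathbb N:\ \left|\frac kN-1\right|\leq\varepsilon,\ \left|\frac mN-1\right|\leq\varepsilon}\left|\langle xP_{k,N},Q_{m,N}\rangle_{L^2(\mu_N)}\right|=o(N^{1/n})\qquad\text{as }N\to\infty .$$ Then, for all $\ell\in\mathbb N$, $$\lim_{N\to\infty}\left|\int x^\ell\,\hat\mu^N(\mathrm dx)-\int x^\ell\,\nu_N(\mathrm dx)\right|=0,\qquad \mathbb P\text{-almost surely}.$$
   Context: $\mathbb N=\{0,1,2,\dots\}$. All functions are real-valued and $\langle f,g\rangle_{L^2(\mu)}=\int fg\,\mathrm d\mu$. Biorthogonal Ensemble: for each $N\ge1$ let $\mu_N$ be a Borel measure on $\mathbb R$ and $(P_{k,N})_{k=0}^{N-1}$, $(Q_{k,N})_{k=0}^{N-1}$ two families in $L^2(\mu_N)$ with $\langle P_{k,N},Q_{m,N}\rangle_{L^2(\mu_N)}=\delta_{km}$ for $0\le k,m\le N-1$, such that $$\frac1{N!}\det\big[P_{k-1,N}(x_i)\big]_{i,k=1}^N\det\big[Q_{k-1,N}(x_i)\big]_{i,k=1}^N\prod_{i=1}^N\mu_N(\mathrm dx_i)$$ is a probability measure $\mathbb P_N$ on $\mathbb R^N$. The real random variables $x_1,\dots,x_N$ (depending on $N$) have this joint distribution; $\mathbb E$ denotes the corresponding expectation. $\mathbb P$ is the product probability measure on $\bigotimes_{N\ge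 1}(\mathbb R^N,\mathbb P_N)$. Structural assumption: (a) for each $N$, the two families can be completed into infinite families $(P_{k,N})_{k\in\mathbb N}$, $(Q_{k,N})_{k\in\mathbb N}$ of $L^2(\mu_N)$ with $\langle P_{k,N},Q_{m,N}\rangle_{L^2(\mu_N)}=\delta_{km}$ for all $k,m\in\mathbb N$ (these completed families are fixed); (b) there is a sequence $(\mathfrak q_N)_{N\ge1}$ of nonnegative integers such that for every integer $n\ge1$, $\mathfrak q_N=o(N^{1/n})$ as $N\to\infty$, and for all $N\ge 1$, $k\in\mathbb N$, the function $x\mapsto xP_{k,N}(x)$ belongs to $\mathrm{Span}(P_{m,N})_{m=0}^{k+\mathfrak q_N}$. Empirical measure: $\hat\mu^N=\frac1N\sum_{i=1}^N\delta_{x_i}$. Average characteristic polynomial: $\chi_N(z)=\mathbb E\big[\prod_{i=1}^N(z-x_i)\big]$, $z\in\mathbb C$, a monic polynomial of degree $N$. Its complex zeros counted with multiplicity are $z_1,\dots,z_N$, and $\nu_N=\frac1N\sum_{i=1}^N\delta_{z_i}$ (so $\int x^\ell\nu_N(\mathrm dx)=\frac1N\sum_i z_i^\ell$). *)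

theory Defs
  imports
    "HOL-Probability.Probability"
    "HOL-Library.Landau_Symbols"
    "HOL-Computational_Algebra.Polynomial"
    "Jordan_Normal_Form.Determinant"
begin

definition in_L2 :: "real measure \<Rightarrow> (real \<Rightarrow> real) \<Rightarrow> bool" where
  "in_L2 M f \<longleftrightarrow> f \<in> borel_measurable M \<and> integrable M (\<lambda>x. (f x)\<^sup>2)"

definition L2_inner :: "real measure \<Rightarrow> (real \<Rightarrow> real) \<Rightarrow> (real \<Rightarrow> real) \<Rightarrow> real" where
  "L2_inner M f g = (\<integral>x. f x * g x \<partial>M)"

definition biorthonormal_on ::
  "nat set \<Rightarrow> real measure \<Rightarrow> (nat \<Rightarrow> real \<Rightarrow> real) \<Rightarrow> (nat \<Rightarrow> real \<Rightarrow> real) \<Rightarrow> bool" where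
  "biorthonormal_on K M p q \<longleftrightarrow>
     (\<forall>k\<in>K. in_L2 M (p k) \<and> in_L2 M (q k)) \<and>
     (\<forall>k\<in>K. \<forall>m\<in>K. L2_inner M (p k) (q m) = (if k = m then 1 else 0))"

text \<open>
  Points of N-dimensional space are the functions on \<open>{..<N}\<close> that form the carrier of
  \<open>PiM {..<N} (\<lambda>_. M)\<close>; the variables are numbered from 0 to N - 1.
\<close>

definition ensemble_density ::
  "nat \<Rightarrow> (nat \<Rightarrow> real \<Rightarrow> real) \<Rightarrow> (nat \<Rightarrow> real \<Rightarrow> real) \<Rightarrow> (nat \<Rightarrow> real) \<Rightarrow> real" where
  "ensemble_density N p q x =
     1 / fact N * Determinant.det (Matrix.mat N N (\<lambda>(i, k). p k (x i)))
                * Determinant.det (Matrix.mat N N (\<lambda>(i, k). q k (x i)))"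

definition ensemble_measure ::
  "nat \<Rightarrow> real measure \<Rightarrow> (nat \<Rightarrow> real \<Rightarrow> real) \<Rightarrow> (nat \<Rightarrow> real \<Rightarrow> real) \<Rightarrow> (nat \<Rightarrow> real) measure" where
  "ensemble_measure N M p q =
     density (PiM {..<N} (\<lambda>_. M)) (\<lambda>x. ennreal (ensemble_density N p q x))"

text \<open>
  Sigma-finiteness is what makes the N-fold product of \<open>M\<close> well defined. As \<open>ennreal\<close>
  truncates negative values, the almost everywhere nonnegativity of the density has to be
  required separately for the signed measure with this density to be a probability measure.
\<close>

definition biorthogonal_ensemble ::
  "nat \<Rightarrow> real measure \<Rightarrow> (nat \<Rightarrow> real \<Rightarrow> real) \<Rightarrow> (nat \<Rightarrow> real \<Rightarrow> real) \<Rightarrow> bool" where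
  "biorthogonal_ensemble N M p q \<longleftrightarrow>
     sets M = sets borel \<and> sigma_finite_measure M \<and>
     biorthonormal_on {..<N} M p q \<and>
     (AE x in PiM {..<N} (\<lambda>_. M). 0 \<le> ensemble_density N p q x) \<and>
     prob_space (ensemble_measure N M p q)"

text \<open>
  Here \<open>P N\<close> and \<open>Q N\<close> are the completed infinite families. Membership in the span is a
  statement about elements of \<open>L\<^sup>2\<close>, hence an identity almost everywhere.
\<close>

definition structural_assumption ::
  "(nat \<Rightarrow> real measure) \<Rightarrow> (nat \<Rightarrow> nat \<Rightarrow> real \<Rightarrow> real) \<Rightarrow> (nat \<Rightarrow> nat \<Rightarrow> real \<Rightarrow> real) \<Rightarrow> bool" where
  "structural_assumption \<mu> P Q \<longleftrightarrow>
     (\<forall>N\<ge>1. biorthonormal_on UNIV (\<mu> N) (P N) (Q N)) \<and>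
     (\<exists>\<qq> :: nat \<Rightarrow> nat.
        (\<forall>n::nat. n \<ge> 1 \<longrightarrow> (\<lambda>N. real (\<qq> N)) \<in> o(\<lambda>N. real N powr (1 / real n))) \<and>
        (\<forall>N\<ge>1. \<forall>k. \<exists>c :: nat \<Rightarrow> real.
           AE x in \<mu> N. x * P N k x = (\<Sum>m\<le>k + \<qq> N. c m * P N m x)))"

definition empirical_measure :: "nat \<Rightarrow> (nat \<Rightarrow> real) \<Rightarrow> real measure" where
  "empirical_measure N x = measure_pmf (pmf_of_multiset (image_mset x (mset_set {..<N})))"

definition avg_char_poly :: "nat \<Rightarrow> (nat \<Rightarrow> real) measure \<Rightarrow> complex poly" where
  "avg_char_poly N \<P> =
     (THE p. \<forall>z. poly p z = (\<integral>x. (\<Prod>i<N. z - complex_of_real (x i)) \<partial>\<P>))"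

text \<open>
  The uniform distribution on the multiset of the complex zeros. The average characteristic
  polynomial is monic of degree N, so this multiset has size N.
\<close>

definition zero_measure :: "nat \<Rightarrow> (nat \<Rightarrow> real) measure \<Rightarrow> complex measure" where
  "zero_measure N \<P> = measure_pmf (pmf_of_multiset (proots (avg_char_poly N \<P>)))"

end

theory Submission
  imports
    Defs
    "Jordan_Normal_Form.Schur_Decomposition"
    "HOL-Real_Asymp.Real_Asymp"
begin

text \<open>
  Write \<open>a k m = \<langle>x P\<^sub>k, Q\<^sub>m\<rangle>\<close>. The recurrence hypothesis makes multiplication by \<open>x\<close> act on the
  span of the \<open>P\<^sub>k\<close> through this infinite matrix, whose row \<open>k\<close> ends at column \<open>k + r\<close> with \<open>r\<close> of
  subpolynomial size, so that \<open>\<langle>x\<^sup>n P\<^sub>k, Q\<^sub>m\<rangle> = (a\<^sup>n)\<^sub>k\<^sub>m\<close>. Let \<open>\<pi>\<close> be the projection onto the first \<open>N\<close>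
  indices.

  The ensemble enters only through Andreief's identity (\<open>expectation_prod_eq_det\<close>), which turns
  \<open>E \<Prod> (z - f(x\<^sub>i))\<close> into the characteristic polynomial of the \<open>N \<times> N\<close> matrix
  \<open>\<langle>f P\<^sub>k, Q\<^sub>m\<rangle>\<close>. For \<open>f = x\<close> it says that the zeros of the average characteristic polynomial are the
  eigenvalues of \<open>\<pi>a\<pi>\<close>, hence their \<open>l\<close>-th power sum is \<open>tr (\<pi>a\<pi>)\<^sup>l\<close>. For \<open>f = x\<^sup>l\<close> the first two
  elementary symmetric functions of the eigenvalues give the mean \<open>tr \<pi>a\<^sup>l\<pi>\<close> of \<open>\<Sum> x\<^sub>i\<^sup>l\<close> and its
  variance \<open>tr \<pi>a\<^sup>2\<^sup>l\<pi> - tr (\<pi>a\<^sup>l\<pi>a\<^sup>l\<pi>)\<close>, whose first term is the mean of \<open>\<Sum> x\<^sub>i\<^sup>2\<^sup>l\<close>.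

  Both the difference \<open>tr \<pi>a\<^sup>l\<pi> - tr (\<pi>a\<pi>)\<^sup>l\<close> and the variance are sums over closed paths that visit
  indices on both sides of \<open>N\<close>. A path climbs by at most \<open>r\<close> per step, and a closed path must climb
  back from its lowest point, so all its vertices lie within a multiple of \<open>r\<close> of \<open>N\<close>. There the
  entries of \<open>a\<close> are subpolynomial by hypothesis, and the number of paths is polynomial in \<open>r\<close>.
  Both quantities are therefore subpolynomial in \<open>N\<close> (\<open>sum_band_pow_corner_diff_le\<close>,
  \<open>sum_band_pow_double_diff_le\<close>). After division by \<open>N\<close> the difference tends to zero, while the
  variances of the normalised power sums are eventually below \<open>N\<^sup>-\<^sup>3\<^sup>/\<^sup>2\<close>, which is summable and so
  gives almost sure convergence.
\<close>

section \<open>Traces of powers and eigenvalues\<close>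

definition mat_trace :: "'a::comm_monoid_add mat \<Rightarrow> 'a" where
  "mat_trace A = (\<Sum>i<dim_row A. A $$ (i, i))"

lemma mat_mult_entry:
  assumes "A \<in> carrier_mat n m" "B \<in> carrier_mat m r" "i < n" "j < r"
  shows "(A * B) $$ (i, j) = (\<Sum>k<m. A $$ (i, k) * B $$ (k, j))"
  using assms by (auto simp: scalar_prod_def atLeast0LessThan intro!: sum.cong)

lemma mat_trace_mult_comm:
  fixes A B :: "'a::comm_semiring_0 mat"
  assumes A: "A \<in> carrier_mat n m" and B: "B \<in> carrier_mat m n"
  shows "mat_trace (A * B) = mat_trace (B * A)"
proof -
  have "mat_trace (A * B) = (\<Sum>i<n. \<Sum>k<m. A $$ (i, k) * B $$ (k, i))"
    unfolding mat_trace_def using A B by (intro sum.cong mat_mult_entry[OF A B]) auto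
  also have "\<dots> = (\<Sum>k<m. \<Sum>i<n. B $$ (k, i) * A $$ (i, k))"
    by (subst sum.swap) (simp add: mult.commute)
  also have "\<dots> = mat_trace (B * A)"
    unfolding mat_trace_def using A B by (intro sum.cong mat_mult_entry[OF B A, symmetric]) auto
  finally show ?thesis .
qed

lemma mat_trace_pow_similar:
  fixes A :: "'a::comm_ring_1 mat"
  assumes "similar_mat A B"
  shows "mat_trace (A ^\<^sub>m l) = mat_trace (B ^\<^sub>m l)"
proof -
  from assms obtain P Q where wit: "similar_mat_wit A B P Q"
    by (auto simp: similar_mat_def)
  define n where "n = dim_row A"
  note D = similar_mat_witD[OF n_def wit]
  have Bl: "B ^\<^sub>m l \<in> carrier_mat n n" using D by simp
  have "mat_trace (A ^\<^sub>m l) = mat_trace ((P * B ^\<^sub>m l) * Q)"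
    by (simp add: similar_mat_wit_pow_id[OF wit])
  also have "\<dots> = mat_trace (Q * (P * B ^\<^sub>m l))"
    using D Bl by (intro mat_trace_mult_comm[of _ n n]) auto
  also have "Q * (P * B ^\<^sub>m l) = B ^\<^sub>m l"
    using D Bl by (simp add: assoc_mult_mat[of Q n n P n "B ^\<^sub>m l" n, symmetric])
  finally show ?thesis .
qed

text \<open>
  In row \<open>i\<close> and column \<open>j \<le> i\<close> of the product \<open>B\<^sup>l B\<close> a summand \<open>k\<close> needs \<open>i \<le> k \<le> j\<close> to be nonzero,
  so only \<open>k = i = j\<close> survives.
\<close>
lemma upper_triangular_pow:
  fixes B :: "'a::comm_ring_1 mat"
  assumes B: "B \<in> carrier_mat n n" and ut: "upper_triangular B"
  shows "\<forall>i<n. \<forall>j<n. (j < i \<longrightarrow> (B ^\<^sub>m l) $$ (i, j) = 0) \<and>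
           (i = j \<longrightarrow> (B ^\<^sub>m l) $$ (i, j) = B $$ (i, i) ^ l)"
proof (induction l)
  case 0
  then show ?case using B by auto
next
  case (Suc l)
  have Bl: "B ^\<^sub>m l \<in> carrier_mat n n" using B by simp
  have ut': "B $$ (k, j) = 0" if "j < k" "k < n" for j k
    using upper_triangularD[OF ut that(1)] that B by auto
  show ?case
  proof (intro allI impI conjI)
    fix i j assume ij: "i < n" "j < n" and "j < i"
    have "(B ^\<^sub>m l) $$ (i, k) * B $$ (k, j) = 0" if "k < n" for k
      using Suc[rule_format, OF ij(1) that] ut'[of j k] that \<open>j < i\<close> by (cases "k < i") auto
    then show "(B ^\<^sub>m Suc l) $$ (i, j) = 0"
      using mat_mult_entry[OF Bl B ij] by simp
  next
    fix i j assume ij: "i < n" "j < n" and "i = j"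
    have "(B ^\<^sub>m l) $$ (i, k) * B $$ (k, j) = (if k = i then B $$ (i, i) ^ l * B $$ (i, i) else 0)"
      if "k < n" for k
      using Suc[rule_format, OF ij(1) that] ut'[of j k] that \<open>i = j\<close>
      by (cases k i rule: linorder_cases) auto
    then have "(\<Sum>k<n. (B ^\<^sub>m l) $$ (i, k) * B $$ (k, j)) =
        (\<Sum>k<n. if k = i then B $$ (i, i) ^ l * B $$ (i, i) else 0)"
      by (intro sum.cong) auto
    then show "(B ^\<^sub>m Suc l) $$ (i, j) = B $$ (i, i) ^ Suc l"
      using mat_mult_entry[OF Bl B ij] ij by (simp add: mult.commute)
  qed
qed

text \<open>
  The eigenvalues with algebraic multiplicity are the diagonal of a Schur form; similarity preserves
  the characteristic polynomial and the traces of all powers.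
\<close>
lemma complex_mat_eigenvalues:
  fixes A :: "complex mat"
  assumes A: "A \<in> carrier_mat n n"
  obtains eig where "char_poly A = (\<Prod>i<n. [:- eig i, 1:])"
    "\<And>l. mat_trace (A ^\<^sub>m l) = (\<Sum>i<n. eig i ^ l)"
proof -
  obtain as where "char_poly A = (\<Prod>a\<leftarrow>as. [:- a, 1:])"
    using char_poly_factorized[OF A] by blast
  from schur_decomposition_exists[OF A this] obtain B where
    B: "B \<in> carrier_mat n n" and ut: "upper_triangular B" and sim: "similar_mat A B"
    by blast
  have "char_poly A = (\<Prod>i<n. [:- (B $$ (i, i)), 1:])"
    using char_poly_similar[OF sim] char_poly_upper_triangular[OF B ut] B
    by (simp add: diag_mat_def prod.list_conv_set_nth atLeast0LessThan)
  moreover have "mat_trace (A ^\<^sub>m l) = (\<Sum>i<n. (B $$ (i, i)) ^ l)" for l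
    using mat_trace_pow_similar[OF sim, of l] upper_triangular_pow[OF B ut, of l] B
    by (simp add: mat_trace_def)
  ultimately show ?thesis by (rule that)
qed

section \<open>Elementary symmetric sums as coefficients\<close>

lemma coeff_prod_linear:
  fixes a :: "'i \<Rightarrow> 'a::comm_ring_1"
  assumes "finite I"
  shows "coeff (\<Prod>i\<in>I. [:1, a i:]) 1 = (\<Sum>i\<in>I. a i)"
    and "2 * coeff (\<Prod>i\<in>I. [:1, a i:]) 2 = (\<Sum>i\<in>I. a i)\<^sup>2 - (\<Sum>i\<in>I. (a i)\<^sup>2)"
proof -
  have "coeff (\<Prod>i\<in>I. [:1, a i:]) 0 = 1 \<and> coeff (\<Prod>i\<in>I. [:1, a i:]) 1 = (\<Sum>i\<in>I. a i) \<and>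
    2 * coeff (\<Prod>i\<in>I. [:1, a i:]) 2 = (\<Sum>i\<in>I. a i)\<^sup>2 - (\<Sum>i\<in>I. (a i)\<^sup>2)"
    using assms
  proof (induction I)
    case (insert x I)
    let ?p = "\<Prod>i\<in>I. [:1, a i:]"
    have eq: "(\<Prod>i\<in>insert x I. [:1, a i:]) = ?p + pCons 0 (Polynomial.smult (a x) ?p)"
      using insert.hyps by (simp add: mult_pCons_left)
    show ?case
      unfolding eq using insert
      by (auto simp: coeff_pCons numeral_2_eq_2 algebra_simps power2_eq_square)
  qed auto
  then show "coeff (\<Prod>i\<in>I. [:1, a i:]) 1 = (\<Sum>i\<in>I. a i)"
    "2 * coeff (\<Prod>i\<in>I. [:1, a i:]) 2 = (\<Sum>i\<in>I. a i)\<^sup>2 - (\<Sum>i\<in>I. (a i)\<^sup>2)"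
    by auto
qed

text \<open>
  This form exhibits each coefficient as a sum of products over subsets, which can be
  integrated term by term.
\<close>
lemma prod_linear_subset_sum:
  fixes a :: "'i \<Rightarrow> 'a::comm_ring_1"
  assumes "finite I"
  shows "(\<Prod>i\<in>I. [:1, a i:]) = (\<Sum>S\<in>Pow I. monom (\<Prod>i\<in>S. a i) (card S))"
proof -
  have *: "(\<Prod>i\<in>S. monom (a i) 1) = monom (\<Prod>i\<in>S. a i) (card S)" if "finite S" for S
    using that by (induction S) (auto simp: mult_monom)
  have "(\<Prod>i\<in>I. [:1, a i:]) = (\<Prod>i\<in>I. monom (a i) 1 + 1)"
    by (intro prod.cong) (auto simp: monom_altdef one_pCons)
  also have "\<dots> = (\<Sum>S\<in>Pow I. (\<Prod>i\<in>S. monom (a i) 1))"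
    using prod_add[OF assms, of "\<lambda>i. monom (a i) 1" "\<lambda>_. 1"] by simp
  also have "\<dots> = (\<Sum>S\<in>Pow I. monom (\<Prod>i\<in>S. a i) (card S))"
    using assms by (intro sum.cong refl *) (auto intro: finite_subset)
  finally show ?thesis .
qed

section \<open>Powers of banded infinite matrices\<close>

text \<open>
  The \<open>n\<close>-th power of an infinite matrix \<open>a\<close> whose row \<open>k\<close> vanishes beyond column \<open>k + q\<close>; cutting
  the sum there keeps it finite. Read as a walk, it climbs by at most \<open>q\<close> per step but may drop
  arbitrarily far.
\<close>
primrec band_pow :: "nat \<Rightarrow> (nat \<Rightarrow> nat \<Rightarrow> 'a::comm_ring_1) \<Rightarrow> nat \<Rightarrow> nat \<Rightarrow> nat \<Rightarrow> 'a" where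
  "band_pow q a 0 k m = (if k = m then 1 else 0)"
| "band_pow q a (Suc n) k m = (\<Sum>j\<le>k + q. a k j * band_pow q a n j m)"

text \<open>
  The compression of \<open>a\<close> to the first \<open>N\<close> indices, extended by zero so that it is again an infinite
  banded matrix.
\<close>
definition corner :: "nat \<Rightarrow> (nat \<Rightarrow> nat \<Rightarrow> 'a::zero) \<Rightarrow> nat \<Rightarrow> nat \<Rightarrow> 'a" where
  "corner N a k m = (if k < N \<and> m < N then a k m else 0)"

lemma band_pow_eq_0: "k + n * q < m \<Longrightarrow> band_pow q a n k m = 0"
proof (induction n arbitrary: k)
  case (Suc n)
  have "a k j * band_pow q a n j m = 0" if "j \<le> k + q" for j
    using Suc.IH[of j] Suc.prems that by simp
  then show ?case by simp
qed auto

text \<open>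
  Along a path of \<open>n\<close> steps from \<open>k\<close> to \<open>m\<close> each step climbs by at most \<open>q\<close>. It therefore stays below
  \<open>k + n * q \<le> hi\<close>, and no vertex is below \<open>m - n * q \<ge> lo\<close>, as \<open>m\<close> could not be reached from there.
  All entries met are thus bounded by \<open>C\<close>, and each step has at most \<open>hi + 1 - lo\<close> targets.
\<close>
lemma abs_band_pow_le:
  fixes a :: "nat \<Rightarrow> nat \<Rightarrow> real"
  assumes bound: "\<And>k m. lo \<le> k \<Longrightarrow> k \<le> hi \<Longrightarrow> lo \<le> m \<Longrightarrow> m \<le> hi \<Longrightarrow> \<bar>a k m\<bar> \<le> C"
    and "0 \<le> C"
    and "lo \<le> k" "k + n * q \<le> hi" "lo + n * q \<le> m"
  shows "\<bar>band_pow q a n k m\<bar> \<le> (C * real (hi + 1 - lo)) ^ n"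
  using assms(3-)
proof (induction n arbitrary: k)
  case (Suc n)
  let ?W = "C * real (hi + 1 - lo)"
  have W: "0 \<le> ?W" using \<open>0 \<le> C\<close> by simp
  have "\<bar>band_pow q a (Suc n) k m\<bar> \<le> (\<Sum>j\<le>k + q. \<bar>a k j * band_pow q a n j m\<bar>)"
    by (simp add: sum_abs)
  also have "\<dots> = (\<Sum>j\<in>{lo..k + q}. \<bar>a k j * band_pow q a n j m\<bar>)"
  proof (rule sum.mono_neutral_right)
    show "\<forall>i\<in>{..k + q} - {lo..k + q}. \<bar>a k i * band_pow q a n i m\<bar> = 0"
      using Suc.prems band_pow_eq_0[of _ n q m a] by auto
  qed auto
  also have "\<dots> \<le> (\<Sum>j\<in>{lo..k + q}. C * ?W ^ n)"
    unfolding abs_mult using Suc.prems \<open>0 \<le> C\<close>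
    by (intro sum_mono mult_mono bound Suc.IH) auto
  also have "\<dots> = real (k + q + 1 - lo) * (C * ?W ^ n)"
    by simp
  also have "\<dots> \<le> real (hi + 1 - lo) * (C * ?W ^ n)"
    using Suc.prems \<open>0 \<le> C\<close> W by (intro mult_right_mono) auto
  also have "\<dots> = ?W ^ Suc n"
    by simp
  finally show ?case .
qed auto

text \<open>
  Starting at \<open>k\<close>, a path of \<open>n\<close> steps never reaches the indices removed by the truncation.
\<close>
lemma band_pow_corner_eq:
  assumes "k + n * q < N" "m < N"
  shows "band_pow q (corner N a) n k m = band_pow q a n k m"
  using assms
proof (induction n arbitrary: k)
  case (Suc n)
  have "corner N a k j * band_pow q (corner N a) n j m = a k j * band_pow q a n j m" if "j \<le> k + q" for j
    using Suc.IH[of j] Suc.prems that by (simp add: corner_def[of N a k j])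
  then show ?case by simp
qed auto

text \<open>
  Only the last \<open>n * q\<close> diagonal entries are affected by the truncation, and each of the two powers
  is bounded separately there. The window starts at \<open>N - 2 * n * q\<close> because a path may descend by
  \<open>n * q\<close> below its endpoint \<open>k \<ge> N - n * q\<close>.
\<close>
lemma sum_band_pow_corner_diff_le:
  fixes a :: "nat \<Rightarrow> nat \<Rightarrow> real"
  assumes bound: "\<And>k m. N - 2 * n * q \<le> k \<Longrightarrow> k \<le> N + n * q \<Longrightarrow> N - 2 * n * q \<le> m \<Longrightarrow> m \<le> N + n * q \<Longrightarrow> \<bar>a k m\<bar> \<le> C"
    and "0 \<le> C" and large: "2 * n * q \<le> N"
  shows "\<bar>(\<Sum>k<N. band_pow q a n k k) - (\<Sum>k<N. band_pow q (corner N a) n k k)\<bar>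
    \<le> real (n * q) * (2 * (C * real (3 * n * q + 1)) ^ n)"
proof -
  have eq: "N + n * q + 1 - (N - 2 * n * q) = 3 * n * q + 1" using large by simp
  have a: "\<bar>band_pow q a n k k\<bar> \<le> (C * real (3 * n * q + 1)) ^ n" if "N - n * q \<le> k" "k < N" for k
    by (rule abs_band_pow_le[of "N - 2 * n * q" "N + n * q" a C k n q k, unfolded eq])
      (use assms that in auto)
  have c: "\<bar>band_pow q (corner N a) n k k\<bar> \<le> (C * real (3 * n * q + 1)) ^ n" if "N - n * q \<le> k" "k < N" for k
    by (rule abs_band_pow_le[of "N - 2 * n * q" "N + n * q" "corner N a" C k n q k, unfolded eq])
      (use assms that in \<open>auto simp: corner_def\<close>)
  have "(\<Sum>k<N. band_pow q a n k k) - (\<Sum>k<N. band_pow q (corner N a) n k k) =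
      (\<Sum>k<N. band_pow q a n k k - band_pow q (corner N a) n k k)"
    by (simp add: sum_subtractf)
  also have "\<dots> = (\<Sum>k\<in>{N - n * q..<N}. band_pow q a n k k - band_pow q (corner N a) n k k)"
    using band_pow_corner_eq[of _ n q N _ a] by (intro sum.mono_neutral_right) auto
  finally have "\<bar>(\<Sum>k<N. band_pow q a n k k) - (\<Sum>k<N. band_pow q (corner N a) n k k)\<bar> \<le>
      (\<Sum>k\<in>{N - n * q..<N}. \<bar>band_pow q a n k k - band_pow q (corner N a) n k k\<bar>)"
    by (simp only: sum_abs)
  also have "\<dots> \<le> (\<Sum>k\<in>{N - n * q..<N}. 2 * (C * real (3 * n * q + 1)) ^ n)"
    by (intro sum_mono) (use a c in \<open>fastforce simp: abs_le_iff\<close>)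
  also have "\<dots> = real (n * q) * (2 * (C * real (3 * n * q + 1)) ^ n)"
    using large by simp
  finally show ?thesis .
qed

lemma band_pow_add:
  assumes "k + n * q \<le> R"
  shows "band_pow q a (n + n') k m = (\<Sum>j\<le>R. band_pow q a n k j * band_pow q a n' j m)"
  using assms
proof (induction n arbitrary: k)
  case 0
  then show ?case by (simp add: if_distrib[of "\<lambda>x. x * _"] cong: if_cong)
next
  case (Suc n)
  have "band_pow q a (Suc n + n') k m = (\<Sum>i\<le>k + q. a k i * (\<Sum>j\<le>R. band_pow q a n i j * band_pow q a n' j m))"
    using Suc by simp
  also have "\<dots> = (\<Sum>j\<le>R. \<Sum>i\<le>k + q. a k i * band_pow q a n i j * band_pow q a n' j m)"
    by (subst sum.swap) (simp add: sum_distrib_left mult.assoc)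
  also have "\<dots> = (\<Sum>j\<le>R. band_pow q a (Suc n) k j * band_pow q a n' j m)"
    by (simp add: sum_distrib_right)
  finally show ?case .
qed

text \<open>
  Expanding the \<open>2 * n\<close>-th power through its midpoint \<open>m\<close>, the difference collects the midpoints
  \<open>m \<ge> N\<close>. Reaching such an \<open>m\<close> from \<open>k < N\<close> in \<open>n\<close> steps forces \<open>k \<ge> N - n * q\<close> and \<open>m \<le> N + n * q\<close>.
\<close>
lemma sum_band_pow_double_diff_le:
  fixes a :: "nat \<Rightarrow> nat \<Rightarrow> real"
  assumes bound: "\<And>k m. N - 2 * n * q \<le> k \<Longrightarrow> k \<le> N + 2 * n * q \<Longrightarrow> N - 2 * n * q \<le> m \<Longrightarrow> m \<le> N + 2 * n * q \<Longrightarrow> \<bar>a k m\<bar> \<le> C"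
    and "0 \<le> C" and large: "2 * n * q \<le> N"
  shows "\<bar>(\<Sum>k<N. band_pow q a (2 * n) k k) - (\<Sum>k<N. \<Sum>m<N. band_pow q a n k m * band_pow q a n m k)\<bar>
    \<le> real (n * q) * (real (n * q + 1) * (C * real (4 * n * q + 1)) ^ (2 * n))"
proof -
  define b where "b = band_pow q a n"
  let ?W = "C * real (4 * n * q + 1)"
  have W: "0 \<le> ?W" using \<open>0 \<le> C\<close> by simp
  have eq: "N + 2 * n * q + 1 - (N - 2 * n * q) = 4 * n * q + 1" using large by simp
  have bb: "\<bar>b k m\<bar> \<le> ?W ^ n" if "N - n * q \<le> k" "k \<le> N + n * q" "N - n * q \<le> m" for k m
    unfolding b_def by (rule abs_band_pow_le[of "N - 2 * n * q" "N + 2 * n * q" a C k n q m, unfolded eq])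
      (use assms that in auto)
  have z: "b k m = 0" if "k + n * q < m" for k m
    using that by (simp add: b_def band_pow_eq_0)
  have "band_pow q a (2 * n) k k = (\<Sum>m<N. b k m * b m k) + (\<Sum>m\<in>{N..N + n * q}. b k m * b m k)"
    if "k < N" for k
  proof -
    have "band_pow q a (2 * n) k k = (\<Sum>m\<le>N + n * q. b k m * b m k)"
      using band_pow_add[of k n q "N + n * q" a n k] that by (simp add: b_def mult_2)
    also have "{..N + n * q} = {..<N} \<union> {N..N + n * q}" by auto
    finally show ?thesis by (subst (asm) sum.union_disjoint) auto
  qed
  then have "(\<Sum>k<N. band_pow q a (2 * n) k k) - (\<Sum>k<N. \<Sum>m<N. b k m * b m k) =
      (\<Sum>k<N. \<Sum>m\<in>{N..N + n * q}. b k m * b m k)"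
    by (simp add: sum.distrib)
  also have "\<dots> = (\<Sum>k\<in>{N - n * q..<N}. \<Sum>m\<in>{N..N + n * q}. b k m * b m k)"
    using z by (intro sum.mono_neutral_right) (auto intro!: sum.neutral)
  also have "\<bar>\<dots>\<bar> \<le> (\<Sum>k\<in>{N - n * q..<N}. \<Sum>m\<in>{N..N + n * q}. \<bar>b k m * b m k\<bar>)"
    by (intro order_trans[OF sum_abs] sum_mono) simp
  also have "\<dots> \<le> (\<Sum>k\<in>{N - n * q..<N}. \<Sum>m\<in>{N..N + n * q}. ?W ^ n * ?W ^ n)"
    unfolding abs_mult using W by (intro sum_mono mult_mono bb) auto
  also have "\<dots> = real (n * q) * (real (n * q + 1) * ?W ^ (2 * n))"
  proof -
    have "card {N - n * q..<N} = n * q" "card {N..N + n * q} = n * q + 1"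
      using large by simp_all
    then show ?thesis by (simp only: sum_constant mult_2 power_add)
  qed
  finally show ?thesis by (simp add: b_def)
qed

section \<open>Product expectations in a biorthogonal ensemble\<close>

lemma in_L2_integrable_mult:
  assumes "in_L2 M f" "in_L2 M g"
  shows "integrable M (\<lambda>x. f x * g x)"
proof (rule Bochner_Integration.integrable_bound)
  show "integrable M (\<lambda>x. (f x)\<^sup>2 + (g x)\<^sup>2)" "(\<lambda>x. f x * g x) \<in> borel_measurable M"
    using assms by (auto simp: in_L2_def)
  have "\<bar>a * b\<bar> \<le> a\<^sup>2 + b\<^sup>2" for a b :: real
  proof -
    have "2 * (\<bar>a\<bar> * \<bar>b\<bar>) \<le> a\<^sup>2 + b\<^sup>2"
      using sum_squares_bound[of "\<bar>a\<bar>" "\<bar>b\<bar>"] by simp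
    moreover have "0 \<le> \<bar>a\<bar> * \<bar>b\<bar>" by simp
    ultimately show ?thesis unfolding abs_mult by linarith
  qed
  then show "AE x in M. norm (f x * g x) \<le> norm ((f x)\<^sup>2 + (g x)\<^sup>2)"
    by auto
qed

locale biorthogonal_points =
  fixes N :: nat and M :: "real measure" and p q :: "nat \<Rightarrow> real \<Rightarrow> real"
  assumes ensemble: "biorthogonal_ensemble N M p q"
begin

abbreviation "\<P> \<equiv> ensemble_measure N M p q"

lemma sets_M: "sets M = sets borel"
  and sigma_finite_M: "sigma_finite_measure M"
  and biorthonormal: "biorthonormal_on {..<N} M p q"
  and AE_ensemble_density_nonneg: "AE x in PiM {..<N} (\<lambda>_. M). 0 \<le> ensemble_density N p q x"
  and prob_space_ensemble: "prob_space \<P>"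
  using ensemble by (auto simp: biorthogonal_ensemble_def)

sublocale product_sigma_finite "\<lambda>_::nat. M"
  by (simp add: product_sigma_finite_def sigma_finite_M)

sublocale prob_space \<P>
  by (rule prob_space_ensemble)

lemma borel_measurable_M_iff: "f \<in> borel_measurable M \<longleftrightarrow> f \<in> borel_measurable borel"
  by (simp add: measurable_cong_sets[OF sets_M refl])

lemma measurable_PiM_coordinate:
  assumes "f \<in> borel_measurable M" "i < N"
  shows "(\<lambda>x. f (x i)) \<in> borel_measurable (PiM {..<N} (\<lambda>_. M))"
  using assms by (intro measurable_compose[OF measurable_component_singleton]) auto

lemma det_families:
  fixes h :: "nat \<Rightarrow> real \<Rightarrow> real"
  shows "Determinant.det (Matrix.mat N N (\<lambda>(i, k). h k (x i))) =
    (\<Sum>\<sigma> | \<sigma> permutes {0..<N}. signof \<sigma> * (\<Prod>i<N. h (\<sigma> i) (x i)))"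
  by (subst det_def'[of _ N])
    (auto intro!: sum.cong prod.cong simp: atLeast0LessThan permutes_in_image[of _ "{..<N}"])

lemma measurable_density: "ensemble_density N p q \<in> borel_measurable (PiM {..<N} (\<lambda>_. M))"
proof -
  have pq: "p k \<in> borel_measurable M" "q k \<in> borel_measurable M" if "k < N" for k
    using biorthonormal that by (auto simp: biorthonormal_on_def in_L2_def)
  have *: "\<sigma> i < N" if "\<sigma> permutes {0..<N}" "i < N" for \<sigma> i
    using permutes_in_image[OF that(1), of i] that by simp
  show ?thesis
    unfolding ensemble_density_def[abs_def] det_families
    by (intro borel_measurable_times borel_measurable_sum borel_measurable_prod
        borel_measurable_const measurable_PiM_coordinate pq) (auto simp: *)
qed

text \<open>
  Both determinants expand into products of functions of single coordinates, so every expectation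
  below reduces to one-dimensional integrals.
\<close>
lemma density_times_prod:
  fixes g :: "nat \<Rightarrow> real \<Rightarrow> complex"
  shows "ensemble_density N p q x *\<^sub>R (\<Prod>i<N. g i (x i)) =
    (\<Sum>\<sigma> | \<sigma> permutes {0..<N}. \<Sum>\<tau> | \<tau> permutes {0..<N}.
      of_real (1 / fact N * signof \<sigma> * signof \<tau>) *
        (\<Prod>i<N. g i (x i) * of_real (p (\<sigma> i) (x i) * q (\<tau> i) (x i))))"
proof -
  let ?Perm = "{\<sigma>. \<sigma> permutes {0..<N}}"
  have expand: "of_real (c * (\<Sum>\<sigma>\<in>?Perm. a \<sigma>) * (\<Sum>\<tau>\<in>?Perm. b \<tau>)) * y =
      (\<Sum>\<sigma>\<in>?Perm. \<Sum>\<tau>\<in>?Perm. of_real c * of_real (a \<sigma>) * of_real (b \<tau>) * y)"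
    for a b :: "(nat \<Rightarrow> nat) \<Rightarrow> real" and c and y :: complex
    by (simp only: mult.assoc sum_product sum_distrib_left sum_distrib_right of_real_sum of_real_mult)
      (rule sum.swap)
  show ?thesis
    unfolding ensemble_density_def det_families scaleR_conv_of_real expand
    by (intro sum.cong refl) (simp only: of_real_mult of_real_prod prod.distrib mult_ac)
qed

text \<open>
  The factors \<open>g i\<close> may depend on the index, so that products over a subset of the points are
  covered by taking \<open>g i = 1\<close> off the subset.
\<close>
lemma
  fixes g :: "nat \<Rightarrow> real \<Rightarrow> complex"
  assumes meas: "\<And>i. i < N \<Longrightarrow> g i \<in> borel_measurable M"
    and int: "\<And>i k m. i < N \<Longrightarrow> k < N \<Longrightarrow> m < N \<Longrightarrow>
      integrable M (\<lambda>x. g i x * of_real (p k x * q m x))"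
  shows integrable_prod: "integrable \<P> (\<lambda>x. \<Prod>i<N. g i (x i))"
    and expectation_prod: "(\<integral>x. (\<Prod>i<N. g i (x i)) \<partial>\<P>) =
      (\<Sum>\<sigma> | \<sigma> permutes {0..<N}. \<Sum>\<tau> | \<tau> permutes {0..<N}.
        of_real (1 / fact N * signof \<sigma> * signof \<tau>) *
          (\<Prod>i<N. \<integral>x. g i x * of_real (p (\<sigma> i) x * q (\<tau> i) x) \<partial>M))"
proof -
  let ?\<Pi> = "PiM {..<N} (\<lambda>_. M)" and ?Perm = "{\<sigma>. \<sigma> permutes {0..<N}}"
  define c :: "(nat \<Rightarrow> nat) \<Rightarrow> (nat \<Rightarrow> nat) \<Rightarrow> complex"
    where "c \<sigma> \<tau> = of_real (1 / fact N * signof \<sigma> * signof \<tau>)" for \<sigma> \<tau>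
  define F where "F \<sigma> \<tau> x = (\<Prod>i<N. g i (x i) * of_real (p (\<sigma> i) (x i) * q (\<tau> i) (x i)))"
    for \<sigma> \<tau> :: "nat \<Rightarrow> nat" and x
  have dens: "ensemble_density N p q x *\<^sub>R (\<Prod>i<N. g i (x i)) =
      (\<Sum>\<sigma>\<in>?Perm. \<Sum>\<tau>\<in>?Perm. c \<sigma> \<tau> * F \<sigma> \<tau> x)" for x
    unfolding density_times_prod c_def F_def ..
  have m: "(\<lambda>x. \<Prod>i<N. g i (x i)) \<in> borel_measurable ?\<Pi>"
    using meas by (intro borel_measurable_prod measurable_compose[OF measurable_component_singleton]) auto
  have *: "\<sigma> i < N" if "\<sigma> permutes {0..<N}" "i < N" for \<sigma> i
    using permutes_in_image[OF that(1), of i] that by simp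
  have i: "integrable M (\<lambda>x. g i x * of_real (p (\<sigma> i) x * q (\<tau> i) x))"
    if "\<sigma> permutes {0..<N}" "\<tau> permutes {0..<N}" "i < N" for \<sigma> \<tau> i
    using that *[of \<sigma> i] *[of \<tau> i] by (intro int) auto
  have I: "integrable ?\<Pi> (F \<sigma> \<tau>)"
    if "\<sigma> permutes {0..<N}" "\<tau> permutes {0..<N}" for \<sigma> \<tau>
    unfolding F_def using i that by (intro product_integrable_prod) auto
  have E: "(\<integral>x. F \<sigma> \<tau> x \<partial>?\<Pi>) =
      (\<Prod>i<N. \<integral>x. g i x * of_real (p (\<sigma> i) x * q (\<tau> i) x) \<partial>M)"
    if "\<sigma> permutes {0..<N}" "\<tau> permutes {0..<N}" for \<sigma> \<tau>
    unfolding F_def using i that by (intro product_integral_prod) auto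
  have int': "integrable ?\<Pi> (\<lambda>x. ensemble_density N p q x *\<^sub>R (\<Prod>i<N. g i (x i)))"
    unfolding dens by (intro Bochner_Integration.integrable_sum integrable_mult_right I) auto
  then show "integrable \<P> (\<lambda>x. \<Prod>i<N. g i (x i))"
    unfolding ensemble_measure_def
    by (subst integrable_density[OF m measurable_density AE_ensemble_density_nonneg])
  have "(\<integral>x. (\<Prod>i<N. g i (x i)) \<partial>\<P>) = (\<integral>x. ensemble_density N p q x *\<^sub>R (\<Prod>i<N. g i (x i)) \<partial>?\<Pi>)"
    unfolding ensemble_measure_def
    by (rule integral_density[OF m measurable_density AE_ensemble_density_nonneg])
  also have "\<dots> = (\<Sum>\<sigma>\<in>?Perm. \<integral>x. (\<Sum>\<tau>\<in>?Perm. c \<sigma> \<tau> * F \<sigma> \<tau> x) \<partial>?\<Pi>)"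
    unfolding dens by (intro Bochner_Integration.integral_sum Bochner_Integration.integrable_sum integrable_mult_right I) auto
  also have "\<dots> = (\<Sum>\<sigma>\<in>?Perm. \<Sum>\<tau>\<in>?Perm. \<integral>x. c \<sigma> \<tau> * F \<sigma> \<tau> x \<partial>?\<Pi>)"
    by (intro sum.cong refl Bochner_Integration.integral_sum integrable_mult_right I) auto
  also have "\<dots> = (\<Sum>\<sigma>\<in>?Perm. \<Sum>\<tau>\<in>?Perm. c \<sigma> \<tau> *
          (\<Prod>i<N. \<integral>x. g i x * of_real (p (\<sigma> i) x * q (\<tau> i) x) \<partial>M))"
    by (intro sum.cong refl) (simp only: integral_mult_right_zero E mem_Collect_eq)
  finally show "(\<integral>x. (\<Prod>i<N. g i (x i)) \<partial>\<P>) = (\<Sum>\<sigma>\<in>?Perm. \<Sum>\<tau>\<in>?Perm.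
      of_real (1 / fact N * signof \<sigma> * signof \<tau>) *
        (\<Prod>i<N. \<integral>x. g i x * of_real (p (\<sigma> i) x * q (\<tau> i) x) \<partial>M))"
    by (simp only: c_def)
qed

text \<open>
  Andreief's identity: for each row permutation \<open>\<sigma>\<close> the sum over \<open>\<tau>\<close> is \<open>sign \<sigma>\<close> times the
  determinant, so the two signs cancel and the \<open>N!\<close> equal terms absorb the normalisation.
\<close>
lemma expectation_prod_eq_det:
  fixes g :: "real \<Rightarrow> complex"
  assumes meas: "g \<in> borel_measurable M"
    and int: "\<And>k m. k < N \<Longrightarrow> m < N \<Longrightarrow> integrable M (\<lambda>x. g x * of_real (p k x * q m x))"
  shows "(\<integral>x. (\<Prod>i<N. g (x i)) \<partial>\<P>) =
    Determinant.det (Matrix.mat N N (\<lambda>(k, m). \<integral>x. g x * of_real (p k x * q m x) \<partial>M))"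
proof -
  define G where "G = (\<lambda>k m. \<integral>x. g x * of_real (p k x * q m x) \<partial>M)"
  let ?G = "Matrix.mat N N (\<lambda>(k, m). G k m)"
  let ?Perm = "{\<sigma>. \<sigma> permutes {0..<N}}"
  have *: "\<sigma> i < N" if "\<sigma> permutes {0..<N}" "i < N" for \<sigma> i
    using permutes_in_image[OF that(1), of i] that by simp
  have row: "(\<Sum>\<tau>\<in>?Perm. signof \<tau> * (\<Prod>i<N. G (\<sigma> i) (\<tau> i))) = signof \<sigma> * Determinant.det ?G"
    if \<sigma>: "\<sigma> permutes {0..<N}" for \<sigma>
  proof -
    have "signof \<sigma> * Determinant.det ?G =
        Determinant.det (Matrix.mat N N (\<lambda>(i, j). ?G $$ (\<sigma> i, j)))"
      by (rule det_permute_rows[symmetric]) (use \<sigma> in auto)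
    also have "\<dots> = (\<Sum>\<tau>\<in>?Perm. signof \<tau> * (\<Prod>i<N. G (\<sigma> i) (\<tau> i)))"
      by (subst det_def'[of _ N]) (auto intro!: sum.cong prod.cong simp: atLeast0LessThan *[unfolded atLeast0LessThan] \<sigma>[unfolded atLeast0LessThan])
    finally show ?thesis by simp
  qed
  have sq: "(signof \<sigma> :: complex) * (signof \<sigma> * c) = c" for \<sigma> :: "nat \<Rightarrow> nat" and c
    by (simp add: sign_def)
  have "(\<integral>x. (\<Prod>i<N. g (x i)) \<partial>\<P>) =
      (\<Sum>\<sigma>\<in>?Perm. \<Sum>\<tau>\<in>?Perm. of_real (1 / fact N * signof \<sigma> * signof \<tau>) * (\<Prod>i<N. G (\<sigma> i) (\<tau> i)))"
    unfolding G_def by (rule expectation_prod) (use assms in auto)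
  also have "\<dots> = (\<Sum>\<sigma>\<in>?Perm. 1 / fact N * signof \<sigma> * (\<Sum>\<tau>\<in>?Perm. signof \<tau> * (\<Prod>i<N. G (\<sigma> i) (\<tau> i))))"
    by (simp add: sum_distrib_left mult_ac)
  also have "\<dots> = (\<Sum>\<sigma>\<in>?Perm. 1 / fact N * Determinant.det ?G)"
    by (intro sum.cong refl) (simp add: row sq)
  also have "\<dots> = Determinant.det ?G"
    by (simp add: card_permutations[of "{0..<N}" N])
  finally show ?thesis by (simp add: G_def)
qed
end

section \<open>Mean and variance of linear statistics\<close>

context biorthogonal_points begin

text \<open>
  For such \<open>f\<close> the function \<open>z - f\<close> satisfies the integrability hypothesis of Andreief's identity.
\<close>
definition entries_integrable :: "(real \<Rightarrow> real) \<Rightarrow> bool" where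
  "entries_integrable f \<longleftrightarrow> f \<in> borel_measurable M \<and>
     (\<forall>k<N. \<forall>m<N. integrable M (\<lambda>x. f x * p k x * q m x))"

text \<open>
  The matrix of the compression of multiplication by \<open>f\<close> to the span of \<open>p 0, \<dots>, p (N - 1)\<close>, taken
  over the complex numbers to have all its eigenvalues.
\<close>
definition compression :: "(real \<Rightarrow> real) \<Rightarrow> complex mat" where
  "compression f = Matrix.mat N N (\<lambda>(k, m). of_real (L2_inner M (\<lambda>x. f x * p k x) (q m)))"

lemma compression_carrier: "compression f \<in> carrier_mat N N"
  by (simp add: compression_def)

lemma integrable_families: "k < N \<Longrightarrow> m < N \<Longrightarrow> integrable M (\<lambda>x. p k x * q m x)"
  using biorthonormal by (intro in_L2_integrable_mult) (auto simp: biorthonormal_on_def)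

lemma entry_integral:
  assumes f: "entries_integrable f" and km: "k < N" "m < N"
  shows "integrable M (\<lambda>x. (z - of_real (f x)) * complex_of_real (p k x * q m x))"
    and "(\<integral>x. (z - of_real (f x)) * complex_of_real (p k x * q m x) \<partial>M) =
      (if k = m then z else 0) - of_real (L2_inner M (\<lambda>x. f x * p k x) (q m))"
proof -
  have eq: "(\<lambda>x. (z - of_real (f x)) * complex_of_real (p k x * q m x)) =
      (\<lambda>x. z * complex_of_real (p k x * q m x) - complex_of_real (f x * p k x * q m x))"
    by (auto simp: algebra_simps)
  have 1: "integrable M (\<lambda>x. complex_of_real (p k x * q m x))"
    using integrable_families[OF km] by (simp only: complex_of_real_integrable_eq)
  have 2: "integrable M (\<lambda>x. complex_of_real (f x * p k x * q m x))"
    using f km by (simp only: complex_of_real_integrable_eq entries_integrable_def)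
  show "integrable M (\<lambda>x. (z - of_real (f x)) * complex_of_real (p k x * q m x))"
    unfolding eq by (intro Bochner_Integration.integrable_diff integrable_mult_right 1 2)
  have "(\<integral>x. p k x * q m x \<partial>M) = (if k = m then 1 else 0)"
    using biorthonormal km by (auto simp: biorthonormal_on_def L2_inner_def)
  then show "(\<integral>x. (z - of_real (f x)) * complex_of_real (p k x * q m x) \<partial>M) =
      (if k = m then z else 0) - of_real (L2_inner M (\<lambda>x. f x * p k x) (q m))"
    unfolding eq
    by (subst Bochner_Integration.integral_diff[OF integrable_mult_right[OF 1] 2])
      (simp_all only: integral_mult_right_zero integral_complex_of_real L2_inner_def, simp)
qed

text \<open>
  By biorthonormality the entries of Andreief's determinant for \<open>z - f\<close> are those of \<open>z\<close> times the
  identity minus the compression of \<open>f\<close>.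
\<close>
lemma expectation_char_poly:
  assumes f: "entries_integrable f"
  shows "(\<integral>x. (\<Prod>i<N. z - of_real (f (x i))) \<partial>\<P>) = poly (char_poly (compression f)) z"
proof -
  have m: "(\<lambda>x. z - complex_of_real (f x)) \<in> borel_measurable M"
    using f by (auto simp: entries_integrable_def)
  have "(\<integral>x. (\<Prod>i<N. z - of_real (f (x i))) \<partial>\<P>) = Determinant.det (Matrix.mat N N
      (\<lambda>(k, m). \<integral>x. (z - of_real (f x)) * complex_of_real (p k x * q m x) \<partial>M))"
    by (rule expectation_prod_eq_det[OF m entry_integral(1)[OF f]])
  also have "\<dots> = poly (char_poly (compression f)) z"
    unfolding char_poly_def
    by (rule poly_det_cong[symmetric, of _ N])
      (auto simp: entry_integral(2)[OF f] compression_def char_poly_matrix_def simp del: of_real_mult)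
  finally show ?thesis .
qed

lemma avg_char_poly_eq:
  assumes "entries_integrable (\<lambda>x. x)"
  shows "avg_char_poly N \<P> = char_poly (compression (\<lambda>x. x))"
  unfolding avg_char_poly_def expectation_char_poly[OF assms]
  by (rule the_equality) (auto intro: poly_eqI2 simp: poly_eq_poly_eq_iff[symmetric])

lemma integrable_prod_subset:
  assumes f: "entries_integrable f" and S: "S \<subseteq> {..<N}"
  shows "integrable \<P> (\<lambda>x. \<Prod>i\<in>S. complex_of_real (f (x i)))"
proof -
  have eq: "(\<lambda>x. \<Prod>i\<in>S. complex_of_real (f (x i))) =
      (\<lambda>x. \<Prod>i<N. (if i \<in> S then (\<lambda>y. complex_of_real (f y)) else (\<lambda>_. 1)) (x i))"
    using S by (auto simp: fun_eq_iff if_distrib[of "\<lambda>h. h _"] prod.If_cases Int_absorb1 cong: if_cong)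
  show ?thesis
    unfolding eq
  proof (rule integrable_prod)
    fix i k m assume "i < N" "k < N" "m < N"
    then have "integrable M (\<lambda>x. complex_of_real (f x * p k x * q m x))"
      "integrable M (\<lambda>x. complex_of_real (p k x * q m x))"
      using f integrable_families unfolding complex_of_real_integrable_eq entries_integrable_def by auto
    then show "integrable M (\<lambda>x. (if i \<in> S then (\<lambda>y. complex_of_real (f y)) else (\<lambda>_. 1)) x *
        complex_of_real (p k x * q m x))"
      by (simp add: mult.assoc)
  qed (use f in \<open>auto simp: entries_integrable_def\<close>)
qed

text \<open>
  In expectation the elementary symmetric functions of the values \<open>f(x\<^sub>i)\<close> are those of the eigenvalues
  of the compression: reversing the characteristic polynomial gives
  \<open>E \<Prod> (1 + t f(x\<^sub>i)) = \<Prod> (1 + t \<lambda>\<^sub>i)\<close> for all \<open>t\<close>, and coefficients of \<open>t\<^sup>j\<close> can be compared.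
\<close>
lemma
  assumes f: "entries_integrable f"
    and eig: "char_poly (compression f) = (\<Prod>i<N. [:- eig i, 1:])"
  shows integrable_coeff: "integrable \<P> (\<lambda>x. poly.coeff (\<Prod>i<N. [:1, complex_of_real (f (x i)):]) j)"
    and expectation_coeff: "(\<integral>x. poly.coeff (\<Prod>i<N. [:1, complex_of_real (f (x i)):]) j \<partial>\<P>) =
      poly.coeff (\<Prod>i<N. [:1, eig i:]) j"
proof -
  define mon where "mon S x = (\<Prod>i\<in>S. complex_of_real (f (x i)))" for S :: "nat set" and x
  have I: "integrable \<P> (mon S)" if "S \<in> Pow {..<N}" for S
    using integrable_prod_subset[OF f, of S] that by (simp add: mon_def[abs_def])
  have F: "(\<Prod>i<N. [:1, complex_of_real (f (x i)):]) = (\<Sum>S\<in>Pow {..<N}. monom (mon S x) (card S))" for x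
    by (simp add: prod_linear_subset_sum mon_def)
  have c: "poly.coeff (\<Prod>i<N. [:1, complex_of_real (f (x i)):]) j =
      (\<Sum>S\<in>Pow {..<N}. (if card S = j then 1 else 0) * mon S x)" for x j
    unfolding F by (auto simp: coeff_sum intro!: sum.cong)
  show "integrable \<P> (\<lambda>x. poly.coeff (\<Prod>i<N. [:1, complex_of_real (f (x i)):]) j)"
    unfolding c by (intro Bochner_Integration.integrable_sum integrable_mult_right I)
  define R where "R = (\<Sum>S\<in>Pow {..<N}. monom (\<integral>x. mon S x \<partial>\<P>) (card S))"
  have "poly R t = poly (\<Prod>i<N. [:1, eig i:]) t" for t
  proof -
    have "poly R t = (\<Sum>S\<in>Pow {..<N}. (\<integral>x. t ^ card S * mon S x \<partial>\<P>))"
      by (simp add: R_def poly_sum poly_monom mult.commute)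
    also have "\<dots> = (\<integral>x. (\<Sum>S\<in>Pow {..<N}. t ^ card S * mon S x) \<partial>\<P>)"
      by (rule Bochner_Integration.integral_sum[symmetric]) (intro integrable_mult_right I)
    also have "\<dots> = (\<integral>x. poly (\<Prod>i<N. [:1, complex_of_real (f (x i)):]) t \<partial>\<P>)"
      unfolding F by (simp add: poly_sum poly_monom mult.commute)
    also have "\<dots> = (\<integral>x. (\<Prod>i<N. 1 + t * complex_of_real (f (x i))) \<partial>\<P>)"
      by (simp add: poly_prod)
    also have "\<dots> = (\<Prod>i<N. 1 + t * eig i)"
    \<comment> \<open>The substitution \<open>z = - 1 / t\<close> in the characteristic polynomial excludes \<open>t = 0\<close>, where both sides are 1.\<close>
    proof (cases "t = 0")
      case False
      have *: "(\<Prod>i<N. 1 + t * a i) = (- t) ^ N * (\<Prod>i<N. - 1 / t - a i)" for a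
      proof -
        have "(- t) ^ N * (\<Prod>i<N. - 1 / t - a i) = (\<Prod>i<N. (- t) * (- 1 / t - a i))"
          by (simp only: prod.distrib prod_constant card_lessThan)
        also have "\<dots> = (\<Prod>i<N. 1 + t * a i)"
          using False by (intro prod.cong) (auto simp: field_simps)
        finally show ?thesis by simp
      qed
      have roots: "poly (\<Prod>i<N. [:- eig i, 1:]) z = (\<Prod>i<N. z - eig i)" for z
        by (simp add: poly_prod)
      show ?thesis
        unfolding * integral_mult_right_zero expectation_char_poly[OF f] eig roots ..
    qed (simp add: prob_space)
    finally show ?thesis by (simp add: poly_prod)
  qed
  then have R: "R = (\<Prod>i<N. [:1, eig i:])"
    by (simp add: poly_eq_poly_eq_iff[symmetric] fun_eq_iff)
  have "(\<integral>x. poly.coeff (\<Prod>i<N. [:1, complex_of_real (f (x i)):]) j \<partial>\<P>) =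
      (\<Sum>S\<in>Pow {..<N}. (\<integral>x. (if card S = j then 1 else 0) * mon S x \<partial>\<P>))"
    unfolding c by (rule Bochner_Integration.integral_sum) (intro integrable_mult_right I)
  also have "\<dots> = poly.coeff R j"
    by (auto simp: R_def coeff_sum intro!: sum.cong)
  finally show "(\<integral>x. poly.coeff (\<Prod>i<N. [:1, complex_of_real (f (x i)):]) j \<partial>\<P>) =
      poly.coeff (\<Prod>i<N. [:1, eig i:]) j"
    by (simp add: R)
qed

lemma mat_trace_compression:
  "mat_trace (compression f) = of_real (\<Sum>k<N. L2_inner M (\<lambda>x. f x * p k x) (q k))"
  by (simp add: mat_trace_def compression_def)

lemma
  assumes f: "entries_integrable f"
  shows integrable_linear_statistic: "integrable \<P> (\<lambda>x. \<Sum>i<N. f (x i))"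
    and expectation_linear_statistic:
      "(\<integral>x. (\<Sum>i<N. f (x i)) \<partial>\<P>) = (\<Sum>k<N. L2_inner M (\<lambda>x. f x * p k x) (q k))"
proof -
  obtain eig where eig: "char_poly (compression f) = (\<Prod>i<N. [:- eig i, 1:])"
    and tr: "\<And>l. mat_trace (compression f ^\<^sub>m l) = (\<Sum>i<N. eig i ^ l)"
    using complex_mat_eigenvalues[OF compression_carrier] by blast
  have eq: "poly.coeff (\<Prod>i<N. [:1, complex_of_real (f (x i)):]) 1 =
      complex_of_real (\<Sum>i<N. f (x i))" for x
    using coeff_prod_linear(1)[of "{..<N}"] by simp
  show "integrable \<P> (\<lambda>x. \<Sum>i<N. f (x i))"
    using integrable_coeff[OF f eig, of 1] unfolding eq by (simp only: complex_of_real_integrable_eq)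
  have "complex_of_real (\<integral>x. (\<Sum>i<N. f (x i)) \<partial>\<P>) = (\<Sum>i<N. eig i)"
    using expectation_coeff[OF f eig, of 1] unfolding eq integral_complex_of_real
    using coeff_prod_linear(1)[of "{..<N}" eig] by simp
  also have "\<dots> = mat_trace (compression f)"
    using tr[of 1] compression_carrier[of f] by simp
  finally show "(\<integral>x. (\<Sum>i<N. f (x i)) \<partial>\<P>) = (\<Sum>k<N. L2_inner M (\<lambda>x. f x * p k x) (q k))"
    unfolding mat_trace_compression of_real_eq_iff .
qed

text \<open>
  The second elementary symmetric function determines the expectation of the off-diagonal part
  \<open>(\<Sum> f(x\<^sub>i))\<^sup>2 - \<Sum> f(x\<^sub>i)\<^sup>2\<close> as \<open>(tr A)\<^sup>2 - tr A\<^sup>2\<close>, with \<open>A\<close> the compression of \<open>f\<close>. The diagonal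
  part is a linear statistic of \<open>f\<^sup>2\<close>, and \<open>tr A\<close> is the mean.
\<close>
lemma
  assumes f: "entries_integrable f" and f2: "entries_integrable (\<lambda>x. (f x)\<^sup>2)"
  shows integrable_linear_statistic_power2: "integrable \<P> (\<lambda>x. (\<Sum>i<N. f (x i))\<^sup>2)"
    and variance_linear_statistic: "variance (\<lambda>x. \<Sum>i<N. f (x i)) =
      (\<Sum>k<N. L2_inner M (\<lambda>x. (f x)\<^sup>2 * p k x) (q k)) -
      (\<Sum>k<N. \<Sum>m<N. L2_inner M (\<lambda>x. f x * p k x) (q m) * L2_inner M (\<lambda>x. f x * p m x) (q k))"
proof -
  let ?S = "\<lambda>x::nat \<Rightarrow> real. \<Sum>i<N. f (x i)"
  let ?D = "\<lambda>x::nat \<Rightarrow> real. \<Sum>i<N. (f (x i))\<^sup>2"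
  define a where "a k m = L2_inner M (\<lambda>x. f x * p k x) (q m)" for k m
  obtain eig where eig: "char_poly (compression f) = (\<Prod>i<N. [:- eig i, 1:])"
    and tr: "\<And>l. mat_trace (compression f ^\<^sub>m l) = (\<Sum>i<N. eig i ^ l)"
    using complex_mat_eigenvalues[OF compression_carrier] by blast
  have eq: "2 * poly.coeff (\<Prod>i<N. [:1, complex_of_real (f (x i)):]) 2 =
      complex_of_real ((?S x)\<^sup>2 - ?D x)" for x
    by (subst coeff_prod_linear(2)) simp_all
  have int: "integrable \<P> (\<lambda>x. (?S x)\<^sup>2 - ?D x)"
    using integrable_mult_right[OF integrable_coeff[OF f eig, of 2], of 2]
    unfolding eq by (simp only: complex_of_real_integrable_eq)
  have intD: "integrable \<P> ?D"
    by (rule integrable_linear_statistic[OF f2])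
  show int2: "integrable \<P> (\<lambda>x. (?S x)\<^sup>2)"
    using Bochner_Integration.integrable_add[OF int intD] by simp
  have mean: "complex_of_real (\<integral>x. ?S x \<partial>\<P>) = (\<Sum>i<N. eig i)"
    using tr[of 1] compression_carrier[of f]
    by (simp add: expectation_linear_statistic[OF f] mat_trace_compression)
  have sq: "(\<Sum>i<N. (eig i)\<^sup>2) = complex_of_real (\<Sum>k<N. \<Sum>m<N. a k m * a m k)"
  proof -
    have "compression f ^\<^sub>m 2 = compression f * compression f"
      using compression_carrier[of f] by (simp add: numeral_2_eq_2)
    then have "(\<Sum>i<N. (eig i)\<^sup>2) = mat_trace (compression f * compression f)"
      using tr[of 2] by simp
    also have "\<dots> = (\<Sum>k<N. (compression f * compression f) $$ (k, k))"
      using compression_carrier[of f] by (simp add: mat_trace_def)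
    also have "\<dots> = (\<Sum>k<N. \<Sum>m<N. compression f $$ (k, m) * compression f $$ (m, k))"
      by (intro sum.cong mat_mult_entry[OF compression_carrier compression_carrier]) auto
    also have "\<dots> = complex_of_real (\<Sum>k<N. \<Sum>m<N. a k m * a m k)"
      by (simp add: compression_def a_def)
    finally show ?thesis .
  qed
  have "complex_of_real (\<integral>x. (?S x)\<^sup>2 - ?D x \<partial>\<P>) = (\<integral>x. complex_of_real ((?S x)\<^sup>2 - ?D x) \<partial>\<P>)"
    by (rule integral_complex_of_real[symmetric])
  also have "\<dots> = 2 * poly.coeff (\<Prod>i<N. [:1, eig i:]) 2"
    unfolding eq[symmetric] integral_mult_right_zero expectation_coeff[OF f eig] ..
  also have "\<dots> = (\<Sum>i<N. eig i)\<^sup>2 - (\<Sum>i<N. (eig i)\<^sup>2)"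
    by (rule coeff_prod_linear(2)) simp
  also have "\<dots> = complex_of_real ((\<integral>x. ?S x \<partial>\<P>)\<^sup>2 - (\<Sum>k<N. \<Sum>m<N. a k m * a m k))"
    unfolding sq mean[symmetric] by simp
  finally have "(\<integral>x. (?S x)\<^sup>2 - ?D x \<partial>\<P>) = (\<integral>x. ?S x \<partial>\<P>)\<^sup>2 - (\<Sum>k<N. \<Sum>m<N. a k m * a m k)"
    unfolding of_real_eq_iff .
  moreover have "(\<integral>x. (?S x)\<^sup>2 - ?D x \<partial>\<P>) = (\<integral>x. (?S x)\<^sup>2 \<partial>\<P>) - (\<integral>x. ?D x \<partial>\<P>)"
    by (rule Bochner_Integration.integral_diff[OF int2 intD])
  moreover have "variance ?S = (\<integral>x. (?S x)\<^sup>2 \<partial>\<P>) - (\<integral>x. ?S x \<partial>\<P>)\<^sup>2"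
    by (rule variance_eq[OF integrable_linear_statistic[OF f] int2])
  ultimately show "variance ?S = (\<Sum>k<N. L2_inner M (\<lambda>x. (f x)\<^sup>2 * p k x) (q k)) -
      (\<Sum>k<N. \<Sum>m<N. L2_inner M (\<lambda>x. f x * p k x) (q m) * L2_inner M (\<lambda>x. f x * p m x) (q k))"
    using expectation_linear_statistic[OF f2] by (simp add: a_def)
qed
end

section \<open>Power sums of an ensemble with a banded recurrence\<close>

text \<open>
  The fixed superset \<open>S\<close> lets the induction on the multiset leave the range of summation alone.
\<close>
lemma sum_mset_eq_sum_count:
  fixes f :: "'a \<Rightarrow> 'b::real_vector"
  assumes "finite S" "set_mset A \<subseteq> S"
  shows "(\<Sum>x\<in>#A. f x) = (\<Sum>x\<in>S. real (count A x) *\<^sub>R f x)"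
  using assms(2)
proof (induction A)
  case (add y A)
  have "(\<Sum>x\<in>S. real (count (add_mset y A) x) *\<^sub>R f x) =
      (\<Sum>x\<in>S. real (count A x) *\<^sub>R f x + (if x = y then f x else 0))"
    by (intro sum.cong) (auto simp: scaleR_left_distrib)
  also have "\<dots> = (\<Sum>x\<in>S. real (count A x) *\<^sub>R f x) + f y"
    using add.prems assms(1) by (simp add: sum.distrib)
  finally show ?case using add by simp
qed auto

lemma integral_pmf_of_multiset:
  fixes f :: "'a \<Rightarrow> 'b::{banach, second_countable_topology}"
  assumes "A \<noteq> {#}"
  shows "(\<integral>x. f x \<partial>measure_pmf (pmf_of_multiset A)) = (1 / real (size A)) *\<^sub>R (\<Sum>x\<in>#A. f x)"
proof -
  have "(\<integral>x. f x \<partial>measure_pmf (pmf_of_multiset A)) =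
      (\<Sum>x\<in>set_mset A. pmf (pmf_of_multiset A) x *\<^sub>R f x)"
    using assms by (intro integral_measure_pmf) auto
  also have "\<dots> = (1 / real (size A)) *\<^sub>R (\<Sum>x\<in>set_mset A. real (count A x) *\<^sub>R f x)"
    using assms by (simp add: scaleR_sum_right)
  finally show ?thesis by (simp add: sum_mset_eq_sum_count[of "set_mset A"])
qed

lemma integral_pmf_of_multiset_image:
  fixes f :: "'a \<Rightarrow> 'b::{banach, second_countable_topology}"
  assumes "finite I" "I \<noteq> {}"
  shows "(\<integral>x. f x \<partial>measure_pmf (pmf_of_multiset (image_mset h (mset_set I)))) =
    (1 / real (card I)) *\<^sub>R (\<Sum>i\<in>I. f (h i))"
  using assms
  by (subst integral_pmf_of_multiset)
    (simp_all add: mset_set_empty_iff multiset.map_comp o_def sum_unfold_sum_mset)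

text \<open>
  One member of the sequence: an ensemble of fixed size \<open>N\<close> with completed families and a
  recurrence of width \<open>r\<close>.
\<close>
locale banded_ensemble = biorthogonal_points +
  fixes r :: nat
  assumes biorthonormal_UNIV: "biorthonormal_on UNIV M p q"
    and span: "\<And>k. \<exists>c. AE x in M. x * p k x = (\<Sum>m\<le>k + r. c m * p m x)"
begin

definition entry :: "nat \<Rightarrow> nat \<Rightarrow> real" where
  "entry k m = L2_inner M (\<lambda>x. x * p k x) (q m)"

lemma measurable_families: "p k \<in> borel_measurable M" "q k \<in> borel_measurable M"
  using biorthonormal_UNIV by (auto simp: biorthonormal_on_def in_L2_def)

lemma integrable_p_q: "integrable M (\<lambda>x. p k x * q m x)"
  using biorthonormal_UNIV by (intro in_L2_integrable_mult) (auto simp: biorthonormal_on_def)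

lemma integral_p_q: "(\<integral>x. p k x * q m x \<partial>M) = (if k = m then 1 else 0)"
  using biorthonormal_UNIV by (auto simp: biorthonormal_on_def L2_inner_def)

lemma measurable_id_M: "(\<lambda>x. x) \<in> borel_measurable M"
  by (simp add: borel_measurable_M_iff)

text \<open>
  A function in the span of the \<open>p j\<close> inherits integrability against each \<open>q m\<close>, and biorthonormality
  reads off its coefficients. Only almost everywhere equality is available, which suffices for both.
\<close>
lemma
  assumes h: "AE x in M. h x = (\<Sum>j\<le>R. c j * p j x)" and meas: "h \<in> borel_measurable M"
  shows integrable_expansion: "integrable M (\<lambda>x. h x * q m x)"
    and L2_inner_expansion: "L2_inner M h (q m) = (if m \<le> R then c m else 0)"
proof -
  have m1: "(\<lambda>x. h x * q m x) \<in> borel_measurable M"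
    by (intro borel_measurable_times meas measurable_families)
  have m2: "(\<lambda>x. \<Sum>j\<le>R. c j * (p j x * q m x)) \<in> borel_measurable M"
    by (intro borel_measurable_sum borel_measurable_times borel_measurable_const measurable_families)
  have eq: "AE x in M. h x * q m x = (\<Sum>j\<le>R. c j * (p j x * q m x))"
    using h by eventually_elim (simp add: sum_distrib_right mult.assoc)
  have I: "integrable M (\<lambda>x. c j * (p j x * q m x))" for j
    by (intro integrable_mult_right integrable_p_q)
  show "integrable M (\<lambda>x. h x * q m x)"
    unfolding integrable_cong_AE[OF m1 m2 eq] by (intro Bochner_Integration.integrable_sum I)
  have "L2_inner M h (q m) = (\<Sum>j\<le>R. \<integral>x. c j * (p j x * q m x) \<partial>M)"
    unfolding L2_inner_def integral_cong_AE[OF m1 m2 eq] by (intro Bochner_Integration.integral_sum I)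
  also have "\<dots> = (if m \<le> R then c m else 0)"
    by (simp add: integral_p_q if_distrib[of "\<lambda>x. _ * x"] cong: if_cong)
  finally show "L2_inner M h (q m) = (if m \<le> R then c m else 0)" .
qed

lemma
  shows AE_mult_expansion: "AE x in M. x * p k x = (\<Sum>j\<le>k + r. entry k j * p j x)"
    and entry_eq_0: "k + r < m \<Longrightarrow> entry k m = 0"
proof -
  obtain c where c: "AE x in M. x * p k x = (\<Sum>j\<le>k + r. c j * p j x)"
    using span by blast
  have e: "entry k m = (if m \<le> k + r then c m else 0)" for m
    unfolding entry_def
    by (intro L2_inner_expansion[OF c] borel_measurable_times measurable_id_M measurable_families)
  show "AE x in M. x * p k x = (\<Sum>j\<le>k + r. entry k j * p j x)"
    using c by (simp add: e)
  show "k + r < m \<Longrightarrow> entry k m = 0"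
    by (simp add: e)
qed

text \<open>
  A common upper limit \<open>R\<close> for all rows makes the interchange of sums in the induction
  a matter of rectangular ranges; the extra coefficients vanish.
\<close>
lemma AE_power_expansion:
  assumes "k + n * r \<le> R"
  shows "AE x in M. x ^ n * p k x = (\<Sum>j\<le>R. band_pow r entry n k j * p j x)"
  using assms
proof (induction n arbitrary: k)
  case 0
  then show ?case by (simp add: if_distrib[of "\<lambda>x. x * _"] cong: if_cong)
next
  case (Suc n)
  have "AE x in M. \<forall>i\<in>{..k + r}. x ^ n * p i x = (\<Sum>j\<le>R. band_pow r entry n i j * p j x)"
    using Suc by (intro AE_finite_allI) auto
  with AE_mult_expansion[of k] show ?case
  proof eventually_elim
    case (elim x)
    have "x ^ Suc n * p k x = x ^ n * (x * p k x)"
      by simp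
    also have "\<dots> = (\<Sum>i\<le>k + r. entry k i * (x ^ n * p i x))"
      unfolding elim(1) by (simp add: sum_distrib_left mult_ac)
    also have "\<dots> = (\<Sum>i\<le>k + r. \<Sum>j\<le>R. entry k i * (band_pow r entry n i j * p j x))"
      using elim(2) by (simp add: sum_distrib_left)
    also have "\<dots> = (\<Sum>j\<le>R. band_pow r entry (Suc n) k j * p j x)"
      by (subst sum.swap) (simp add: sum_distrib_right mult.assoc)
    finally show ?case .
  qed
qed

lemma measurable_power_times: "(\<lambda>x. x ^ n * p k x) \<in> borel_measurable M"
  by (intro borel_measurable_times borel_measurable_power measurable_id_M measurable_families)

lemma L2_inner_power: "L2_inner M (\<lambda>x. x ^ n * p k x) (q m) = band_pow r entry n k m"
  using L2_inner_expansion[OF AE_power_expansion[OF order_refl] measurable_power_times, of n k m]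
    band_pow_eq_0[of k n r m entry] by (auto split: if_splits)

lemma entries_integrable_power: "entries_integrable (\<lambda>x. x ^ n)"
  unfolding entries_integrable_def
  using integrable_expansion[OF AE_power_expansion[OF order_refl] measurable_power_times]
  by (auto intro!: borel_measurable_power measurable_id_M)

lemma expectation_power_sum:
  "(\<integral>x. (\<Sum>i<N. x i ^ l) \<partial>\<P>) = (\<Sum>k<N. band_pow r entry l k k)"
  using expectation_linear_statistic[OF entries_integrable_power, of l] by (simp add: L2_inner_power)

lemma
  shows integrable_power_sum_power2: "integrable \<P> (\<lambda>x. (\<Sum>i<N. x i ^ l)\<^sup>2)"
    and variance_power_sum: "variance (\<lambda>x. \<Sum>i<N. x i ^ l) =
      (\<Sum>k<N. band_pow r entry (2 * l) k k) -
      (\<Sum>k<N. \<Sum>m<N. band_pow r entry l k m * band_pow r entry l m k)"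
proof -
  have eq: "(\<lambda>x::real. (x ^ l)\<^sup>2) = (\<lambda>x. x ^ (2 * l))"
    by (simp add: power_mult[symmetric] mult.commute)
  have f2: "entries_integrable (\<lambda>x. (x ^ l)\<^sup>2)"
    unfolding eq by (rule entries_integrable_power)
  show "integrable \<P> (\<lambda>x. (\<Sum>i<N. x i ^ l)\<^sup>2)"
    by (rule integrable_linear_statistic_power2[OF entries_integrable_power f2])
  show "variance (\<lambda>x. \<Sum>i<N. x i ^ l) = (\<Sum>k<N. band_pow r entry (2 * l) k k) -
      (\<Sum>k<N. \<Sum>m<N. band_pow r entry l k m * band_pow r entry l m k)"
    using variance_linear_statistic[OF entries_integrable_power f2]
    by (simp add: L2_inner_power power_mult[symmetric] mult.commute[of l 2])
qed

text \<open>
  The matrix power multiplies the new factor on the right and \<open>band_pow\<close> on the left, hence the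
  detour through the splitting of a power into factors.
\<close>
lemma compression_pow_entry:
  assumes "k < N" "m < N"
  shows "(compression (\<lambda>x. x) ^\<^sub>m l) $$ (k, m) = of_real (band_pow r (corner N entry) l k m)"
  using assms
proof (induction l arbitrary: k m)
  case 0
  then show ?case using compression_carrier[of "\<lambda>x. x"] by simp
next
  case (Suc l)
  let ?A = "compression (\<lambda>x. x)" and ?c = "corner N entry"
  \<comment> \<open>The first power is the matrix itself because the entries beyond column \<open>j + r\<close> vanish.\<close>
  have one: "band_pow r ?c 1 j m = ?c j m" for j
    using entry_eq_0[of j m] by (simp add: if_distrib[of "\<lambda>x. _ * x"] corner_def cong: if_cong)
  have "(?A ^\<^sub>m Suc l) $$ (k, m) = (\<Sum>j<N. (?A ^\<^sub>m l) $$ (k, j) * ?A $$ (j, m))"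
    using Suc.prems mat_mult_entry[OF pow_carrier_mat[OF compression_carrier] compression_carrier] by simp
  also have "\<dots> = of_real (\<Sum>j<N. band_pow r ?c l k j * ?c j m)"
    using Suc by (simp add: compression_def corner_def[of N entry _ m] entry_def[symmetric])
  also have "(\<Sum>j<N. band_pow r ?c l k j * ?c j m) = (\<Sum>j\<le>N + k + l * r. band_pow r ?c l k j * ?c j m)"
    by (rule sum.mono_neutral_left) (auto simp: corner_def)
  also have "\<dots> = band_pow r ?c (Suc l) k m"
    unfolding Suc_eq_plus1 by (subst band_pow_add[where R = "N + k + l * r"]) (simp, simp only: one)
  finally show ?case .
qed

text \<open>
  The zeros of the average characteristic polynomial are the eigenvalues of the compression of
  multiplication by \<open>x\<close>, so their power sums are traces of its powers.
\<close>
lemma integral_zero_measure_power: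
  assumes "N \<ge> 1"
  shows "(\<integral>z. z ^ l \<partial>zero_measure N \<P>) = of_real ((\<Sum>k<N. band_pow r (corner N entry) l k k) / N)"
proof -
  let ?A = "compression (\<lambda>x. x)"
  obtain eig where eig: "char_poly ?A = (\<Prod>i<N. [:- eig i, 1:])"
    and tr: "\<And>l. mat_trace (?A ^\<^sub>m l) = (\<Sum>i<N. eig i ^ l)"
    using complex_mat_eigenvalues[OF compression_carrier] by blast
  have id: "entries_integrable (\<lambda>x. x)"
    using entries_integrable_power[of 1] by simp
  have roots: "proots (avg_char_poly N \<P>) = image_mset eig (mset_set {..<N})"
    unfolding avg_char_poly_eq[OF id] eig
    by (subst proots_prod) (auto simp: sum_unfold_sum_mset image_mset.compositionality o_def)
  have "(\<integral>z. z ^ l \<partial>zero_measure N \<P>) = (\<Sum>i<N. eig i ^ l) / N"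
    unfolding zero_measure_def roots using assms
    by (subst integral_pmf_of_multiset_image) (auto simp: lessThan_empty_iff scaleR_conv_of_real)
  also have "(\<Sum>i<N. eig i ^ l) = of_real (\<Sum>k<N. band_pow r (corner N entry) l k k)"
    unfolding tr[symmetric] using compression_carrier[of "\<lambda>x. x"]
    by (simp add: mat_trace_def compression_pow_entry)
  finally show ?thesis by simp
qed
end

section \<open>Subpolynomial growth\<close>

text \<open>
  Quantifying over all exponents makes the class closed under products, so the number of factors in
  a path bound does not matter.
\<close>
definition subpolynomial :: "(nat \<Rightarrow> real) \<Rightarrow> bool" where
  "subpolynomial f \<longleftrightarrow> (\<forall>n\<ge>1. f \<in> o(\<lambda>N. real N powr (1 / real n)))"

lemma subpolynomialD: "subpolynomial f \<Longrightarrow> n \<ge> 1 \<Longrightarrow> f \<in> o(\<lambda>N. real N powr (1 / real n))"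
  by (simp add: subpolynomial_def)

lemma subpolynomial_const: "subpolynomial (\<lambda>_. c)"
  unfolding subpolynomial_def
proof (intro allI impI)
  fix n :: nat assume "n \<ge> 1"
  then have "1 / real n > 0" by simp
  then show "(\<lambda>_. c) \<in> o(\<lambda>N. real N powr (1 / real n))"
    by real_asymp
qed

lemma subpolynomial_add: "subpolynomial f \<Longrightarrow> subpolynomial g \<Longrightarrow> subpolynomial (\<lambda>N. f N + g N)"
  by (auto simp: subpolynomial_def intro: sum_in_smallo)

lemma subpolynomial_mult:
  assumes "subpolynomial f" "subpolynomial g"
  shows "subpolynomial (\<lambda>N. f N * g N)"
  unfolding subpolynomial_def
proof (intro allI impI)
  fix n :: nat assume "n \<ge> 1"
  then have "(\<lambda>N. f N * g N) \<in> o(\<lambda>N. real N powr (1 / real (2 * n)) * real N powr (1 / real (2 * n)))"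
    using assms by (intro landau_o.small_mult subpolynomialD) auto
  also have "(\<lambda>N. real N powr (1 / real (2 * n)) * real N powr (1 / real (2 * n))) = (\<lambda>N. real N powr (1 / real n))"
    by (simp add: powr_add[symmetric])
  finally show "(\<lambda>N. f N * g N) \<in> o(\<lambda>N. real N powr (1 / real n))" .
qed

lemma subpolynomial_power: "subpolynomial f \<Longrightarrow> subpolynomial (\<lambda>N. f N ^ m)"
  by (induction m) (auto intro: subpolynomial_const subpolynomial_mult)

section \<open>Almost sure convergence from summable second moments\<close>

text \<open>
  The sum of the squares has finite expectation, hence is almost surely finite, and the terms of a
  convergent series tend to zero.
\<close>
lemma AE_tendsto_zero_if_summable_second_moments:
  fixes Y :: "nat \<Rightarrow> 'a \<Rightarrow> real"
  assumes meas: "\<And>n. Y n \<in> borel_measurable M"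
    and bound: "\<And>n. (\<integral>\<^sup>+x. ennreal ((Y n x)\<^sup>2) \<partial>M) \<le> ennreal (c n)"
    and c: "summable c" "\<And>n. 0 \<le> c n"
  shows "AE x in M. (\<lambda>n. Y n x) \<longlonglongrightarrow> 0"
proof -
  have "(\<integral>\<^sup>+x. (\<Sum>n. ennreal ((Y n x)\<^sup>2)) \<partial>M) = (\<Sum>n. \<integral>\<^sup>+x. ennreal ((Y n x)\<^sup>2) \<partial>M)"
    using meas by (intro nn_integral_suminf) auto
  also have "\<dots> \<le> (\<Sum>n. ennreal (c n))"
    by (intro suminf_le bound) auto
  also have "\<dots> < \<infinity>"
    using c by (simp add: suminf_ennreal2)
  finally have "AE x in M. (\<Sum>n. ennreal ((Y n x)\<^sup>2)) \<noteq> \<infinity>"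
    using meas by (intro nn_integral_noteq_infinite) auto
  then show ?thesis
  proof eventually_elim
    case (elim x)
    then have "summable (\<lambda>n. (Y n x)\<^sup>2)"
      by (intro summable_suminf_not_top) auto
    from summable_LIMSEQ_zero[OF this] show ?case
      by (simp add: power_tendsto_0_iff)
  qed
qed

text \<open>
  The second moment of the \<open>n\<close>-th coordinate is computed under its marginal \<open>M n\<close>. The bound is only
  demanded from \<open>N0\<close> on, which costs a shift of the sequence.
\<close>
lemma AE_PiM_tendsto_zero:
  fixes Z :: "nat \<Rightarrow> 'a \<Rightarrow> real"
  assumes prob: "\<And>n. n \<in> I \<Longrightarrow> prob_space (M n)"
    and I: "\<And>n. n \<ge> N0 \<Longrightarrow> n \<in> I"
    and meas: "\<And>n. n \<ge> N0 \<Longrightarrow> Z n \<in> borel_measurable (M n)"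
    and int: "\<And>n. n \<ge> N0 \<Longrightarrow> integrable (M n) (\<lambda>x. (Z n x)\<^sup>2)"
    and bound: "\<And>n. n \<ge> N0 \<Longrightarrow> (\<integral>x. (Z n x)\<^sup>2 \<partial>M n) \<le> c n"
    and c: "summable c"
  shows "AE \<omega> in PiM I M. (\<lambda>n. Z n (\<omega> n)) \<longlonglongrightarrow> 0"
proof -
  have "AE \<omega> in PiM I M. (\<lambda>n. Z (n + N0) (\<omega> (n + N0))) \<longlonglongrightarrow> 0"
  proof (rule AE_tendsto_zero_if_summable_second_moments)
    fix n
    have n: "n + N0 \<in> I" by (rule I) simp
    show "(\<lambda>\<omega>. Z (n + N0) (\<omega> (n + N0))) \<in> borel_measurable (PiM I M)"
      by (rule measurable_compose[OF measurable_component_singleton[OF n] meas]) simp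
    have "0 \<le> (\<integral>x. (Z (n + N0) x)\<^sup>2 \<partial>M (n + N0))"
      by (intro Bochner_Integration.integral_nonneg) auto
    also have "\<dots> \<le> c (n + N0)"
      by (rule bound) simp
    finally show "0 \<le> c (n + N0)" .
    have "(\<integral>\<^sup>+\<omega>. ennreal ((Z (n + N0) (\<omega> (n + N0)))\<^sup>2) \<partial>PiM I M) =
        (\<integral>\<^sup>+x. ennreal ((Z (n + N0) x)\<^sup>2) \<partial>distr (PiM I M) (M (n + N0)) (\<lambda>\<omega>. \<omega> (n + N0)))"
      using meas[of "n + N0"] n by (subst nn_integral_distr) auto
    also have "\<dots> = (\<integral>\<^sup>+x. ennreal ((Z (n + N0) x)\<^sup>2) \<partial>M (n + N0))"
      by (subst distr_PiM_component[OF prob n]) simp_all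
    also have "\<dots> = ennreal (\<integral>x. (Z (n + N0) x)\<^sup>2 \<partial>M (n + N0))"
      by (intro nn_integral_eq_integral int) auto
    also have "\<dots> \<le> ennreal (c (n + N0))"
      by (intro ennreal_leI bound) simp
    finally show "(\<integral>\<^sup>+\<omega>. ennreal ((Z (n + N0) (\<omega> (n + N0)))\<^sup>2) \<partial>PiM I M) \<le> ennreal (c (n + N0))" .
  next
    show "summable (\<lambda>n. c (n + N0))"
      by (rule summable_ignore_initial_segment[OF c])
  qed
  then show ?thesis
    by eventually_elim (rule LIMSEQ_offset)
qed

section \<open>Empirical moments against moments of the zeros\<close>

context banded_ensemble begin

text \<open>
  The centering constant is the mean of the power sum by \<open>expectation_power_sum\<close>.
\<close>
definition fluctuation :: "nat \<Rightarrow> (nat \<Rightarrow> real) \<Rightarrow> real" where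
  "fluctuation l x = ((\<Sum>i<N. x i ^ l) - (\<Sum>k<N. band_pow r entry l k k)) / N"

lemma fluctuation_moments:
  shows "fluctuation l \<in> borel_measurable \<P>"
    and "integrable \<P> (\<lambda>x. (fluctuation l x)\<^sup>2)"
    and "(\<integral>x. (fluctuation l x)\<^sup>2 \<partial>\<P>) = variance (\<lambda>x. \<Sum>i<N. x i ^ l) / N\<^sup>2"
proof -
  let ?S = "\<lambda>x::nat \<Rightarrow> real. \<Sum>i<N. x i ^ l" and ?m = "\<Sum>k<N. band_pow r entry l k k"
  have S: "integrable \<P> ?S"
    by (rule integrable_linear_statistic[OF entries_integrable_power])
  then show "fluctuation l \<in> borel_measurable \<P>"
    unfolding fluctuation_def[abs_def] by auto
  have eq: "(\<lambda>x. (fluctuation l x)\<^sup>2) = (\<lambda>x. (?S x - ?m)\<^sup>2 / N\<^sup>2)"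
    by (simp add: fluctuation_def power_divide)
  have eq2: "(\<lambda>x. (?S x - ?m)\<^sup>2) = (\<lambda>x. (?S x)\<^sup>2 - 2 * ?m * ?S x + ?m\<^sup>2)"
    by (simp add: power2_diff algebra_simps)
  have "integrable \<P> (\<lambda>x. (?S x - ?m)\<^sup>2)"
    unfolding eq2 by (intro Bochner_Integration.integrable_add Bochner_Integration.integrable_diff
      integrable_power_sum_power2 integrable_mult_right S integrable_const)
  then show "integrable \<P> (\<lambda>x. (fluctuation l x)\<^sup>2)"
    unfolding eq by simp
  show "(\<integral>x. (fluctuation l x)\<^sup>2 \<partial>\<P>) = variance ?S / N\<^sup>2"
    unfolding eq expectation_power_sum by simp
qed

text \<open>
  The mean \<open>tr \<pi>a\<^sup>l\<pi>\<close> is interposed between the random power sum and \<open>tr (\<pi>a\<pi>)\<^sup>l\<close>: the first term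
  is random with small variance, the second deterministic.
\<close>
lemma cmod_empirical_minus_zero_le:
  assumes "N \<ge> 1"
  shows "cmod (complex_of_real (\<integral>y. y ^ l \<partial>empirical_measure N x) - (\<integral>z. z ^ l \<partial>zero_measure N \<P>))
    \<le> \<bar>fluctuation l x\<bar> +
      \<bar>(\<Sum>k<N. band_pow r entry l k k) - (\<Sum>k<N. band_pow r (corner N entry) l k k)\<bar> / N"
proof -
  let ?S = "\<Sum>i<N. x i ^ l" and ?m = "\<Sum>k<N. band_pow r entry l k k"
    and ?c = "\<Sum>k<N. band_pow r (corner N entry) l k k"
  have "(\<integral>y. y ^ l \<partial>empirical_measure N x) = ?S / N"
    unfolding empirical_measure_def using assms
    by (subst integral_pmf_of_multiset_image) (auto simp: lessThan_empty_iff)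
  then have "cmod (complex_of_real (\<integral>y. y ^ l \<partial>empirical_measure N x) - (\<integral>z. z ^ l \<partial>zero_measure N \<P>))
      = cmod (complex_of_real (?S / N - ?c / N))"
    by (simp only: integral_zero_measure_power[OF assms] of_real_diff)
  also have "\<dots> = \<bar>fluctuation l x + (?m - ?c) / N\<bar>"
    unfolding norm_of_real by (simp add: fluctuation_def diff_divide_distrib)
  also have "\<dots> \<le> \<bar>fluctuation l x\<bar> + \<bar>(?m - ?c) / N\<bar>"
    by (rule abs_triangle_ineq)
  finally show ?thesis by simp
qed

end

theorem theorem1p2:
  fixes \<mu> :: "nat \<Rightarrow> real measure"
    and P Q :: "nat \<Rightarrow> nat \<Rightarrow> real \<Rightarrow> real"
    and l :: nat
  assumes "\<And>N. N \<ge> 1 \<Longrightarrow> biorthogonal_ensemble N (\<mu> N) (P N) (Q N)"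
    and "structural_assumption \<mu> P Q"
    and "\<exists>\<epsilon>>0. \<forall>n::nat. n \<ge> 1 \<longrightarrow>
      (\<lambda>N. Max {\<bar>L2_inner (\<mu> N) (\<lambda>x. x * P N k x) (Q N m)\<bar> | k m :: nat.
              \<bar>real k / real N - 1\<bar> \<le> \<epsilon> \<and> \<bar>real m / real N - 1\<bar> \<le> \<epsilon>})
        \<in> o(\<lambda>N. real N powr (1 / real n))"
  shows "AE \<omega> in PiM {1..} (\<lambda>N. ensemble_measure N (\<mu> N) (P N) (Q N)).
    (\<lambda>N. cmod (complex_of_real (\<integral>x. x ^ l \<partial>empirical_measure N (\<omega> N))
             - (\<integral>z. z ^ l \<partial>zero_measure N (ensemble_measure N (\<mu> N) (P N) (Q N)))))
      \<longlonglongrightarrow> 0"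
proof -
  obtain r :: "nat \<Rightarrow> nat" where r: "subpolynomial (\<lambda>N. real (r N))"
    and span: "\<And>N k. N \<ge> 1 \<Longrightarrow> \<exists>c. AE x in \<mu> N. x * P N k x = (\<Sum>m\<le>k + r N. c m * P N m x)"
    and bi: "\<And>N. N \<ge> 1 \<Longrightarrow> biorthonormal_on UNIV (\<mu> N) (P N) (Q N)"
    using assms(2) unfolding structural_assumption_def subpolynomial_def by blast
  define a where "a N k m = L2_inner (\<mu> N) (\<lambda>x. x * P N k x) (Q N m)" for N k m
  define B where "B \<epsilon> N = Max {\<bar>a N k m\<bar> | k m :: nat.
      \<bar>real k / real N - 1\<bar> \<le> \<epsilon> \<and> \<bar>real m / real N - 1\<bar> \<le> \<epsilon>}" for \<epsilon> N
  obtain \<epsilon> where \<epsilon>: "\<epsilon> > 0" and B: "subpolynomial (B \<epsilon>)"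
    using assms(3) unfolding subpolynomial_def B_def[abs_def] a_def by blast
  have ens: "banded_ensemble N (\<mu> N) (P N) (Q N) (r N)" if "N \<ge> 1" for N
    using assms(1)[OF that] span[OF that] bi[OF that] by unfold_locales
  have entry: "banded_ensemble.entry (\<mu> N) (P N) (Q N) = a N" if "N \<ge> 1" for N
    by (intro ext) (simp add: banded_ensemble.entry_def[OF ens[OF that]] a_def)
  \<comment> \<open>The maximum in the hypothesis ranges over a finite set, since its indices are at most \<open>(1 + \<epsilon>) N\<close>.\<close>
  have B_ge: "\<bar>a N k m\<bar> \<le> B \<epsilon> N"
    if "N \<ge> 1" "\<bar>real k / real N - 1\<bar> \<le> \<epsilon>" "\<bar>real m / real N - 1\<bar> \<le> \<epsilon>" for N k m
    unfolding B_def
  proof (rule Max_ge)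
    let ?W = "{k::nat. \<bar>real k / real N - 1\<bar> \<le> \<epsilon>}"
    have "k \<le> nat \<lceil>(1 + \<epsilon>) * N\<rceil>" if "k \<in> ?W" for k
    proof -
      have "real k / real N \<le> 1 + \<epsilon>" using that by (simp add: abs_le_iff)
      then have "real k \<le> (1 + \<epsilon>) * N" using \<open>N \<ge> 1\<close> by (simp add: divide_le_eq)
      then show ?thesis by linarith
    qed
    then have "finite ?W"
      by (intro finite_subset[of ?W "{..nat \<lceil>(1 + \<epsilon>) * N\<rceil>}"]) auto
    then have "finite ((\<lambda>(k, m). \<bar>a N k m\<bar>) ` (?W \<times> ?W))"
      by simp
    then show "finite {\<bar>a N k m\<bar> | k m :: nat. \<bar>real k / real N - 1\<bar> \<le> \<epsilon> \<and> \<bar>real m / real N - 1\<bar> \<le> \<epsilon>}"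
      by (rule finite_subset[rotated]) auto
  qed (use that in blast)
  have B_nonneg: "0 \<le> B \<epsilon> N" if "N \<ge> 1" for N
    using B_ge[OF that, of N N] \<epsilon> that by simp
  \<comment> \<open>\<open>D\<close> bounds the change of the trace under truncation, \<open>V\<close> the variance of the power sum.\<close>
  define D where "D N = real (l * r N) * (2 * (B \<epsilon> N * real (3 * l * r N + 1)) ^ l)" for N
  define V where "V N = real (l * r N) *
      (real (l * r N + 1) * (B \<epsilon> N * real (4 * l * r N + 1)) ^ (2 * l))" for N
  have lin: "subpolynomial (\<lambda>N. real (c * r N))" "subpolynomial (\<lambda>N. real (c * r N + 1))" for c
    using r by (simp_all only: of_nat_mult of_nat_add)
      (intro subpolynomial_mult subpolynomial_add subpolynomial_const; assumption)+
  have D: "subpolynomial D" and V: "subpolynomial V"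
    unfolding D_def[abs_def] V_def[abs_def]
    by (intro subpolynomial_mult subpolynomial_power subpolynomial_const lin B)+

  \<comment> \<open>As \<open>r\<close> is sublinear, the indices within \<open>2 l r\<close> of \<open>N\<close> end up in the window of relative width \<open>\<epsilon>\<close>.\<close>
  have "\<forall>\<^sub>F N in sequentially. norm (real (r N)) \<le> min \<epsilon> 1 / (2 * real l + 1) * norm (real N powr (1 / real 1))"
    using subpolynomialD[OF r, of 1] \<epsilon> by (intro landau_o.smallD) auto
  moreover have "\<forall>\<^sub>F N in sequentially. \<bar>V N\<bar> \<le> real N powr (1 / 2)"
    using landau_o.smallD[OF subpolynomialD[OF V, of 2], of 1] by simp
  ultimately have "\<forall>\<^sub>F N in sequentially. N \<ge> 1 \<and> 2 * l * r N \<le> \<epsilon> * N \<and> 2 * l * r N \<le> N \<and> V N \<le> real N powr (1 / 2)"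
    using eventually_ge_at_top[of 1]
  proof eventually_elim
    case (elim N)
    have "(2 * real l + 1) * real (r N) \<le> min \<epsilon> 1 * N"
      using elim by (simp add: field_simps)
    then have "2 * real l * real (r N) \<le> min \<epsilon> 1 * N"
      by (simp add: distrib_right)
    moreover have "min \<epsilon> 1 * N \<le> \<epsilon> * N" "min \<epsilon> 1 * N \<le> 1 * real N"
      by (intro mult_right_mono; simp)+
    ultimately have "real (2 * l * r N) \<le> \<epsilon> * N" "real (2 * l * r N) \<le> real N"
      by simp_all
    moreover from this(2) have "2 * l * r N \<le> N"
      by (rule of_nat_le_iff[THEN iffD1])
    moreover have "V N \<le> real N powr (1 / 2)"
      using elim by linarith
    ultimately show ?case using elim by blast
  qed
  then obtain N0 where N0: "\<And>N. N \<ge> N0 \<Longrightarrow> N \<ge> 1" "\<And>N. N \<ge> N0 \<Longrightarrow> 2 * l * r N \<le> \<epsilon> * N"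
    "\<And>N. N \<ge> N0 \<Longrightarrow> 2 * l * r N \<le> N" "\<And>N. N \<ge> N0 \<Longrightarrow> V N \<le> real N powr (1 / 2)"
    unfolding eventually_sequentially by blast
  \<comment> \<open>Beyond \<open>N0\<close> the entries that closed paths across \<open>N\<close> can meet are controlled by the hypothesis.\<close>
  have window: "\<bar>a N k m\<bar> \<le> B \<epsilon> N"
    if N: "N \<ge> N0" and "N - 2 * l * r N \<le> k" "k \<le> N + 2 * l * r N" "N - 2 * l * r N \<le> m" "m \<le> N + 2 * l * r N"
    for N k m
  proof -
    have *: "\<bar>real j / real N - 1\<bar> \<le> \<epsilon>" if "N - 2 * l * r N \<le> j" "j \<le> N + 2 * l * r N" for j
    proof -
      have "\<bar>real j - real N\<bar> \<le> real (2 * l * r N)"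
        using that by linarith
      also have "\<dots> \<le> \<epsilon> * N" by (rule N0[OF N])
      finally have "\<bar>real j - real N\<bar> / N \<le> \<epsilon>"
        using N0(1)[OF N] by (simp add: divide_le_eq)
      moreover have "real j / real N - 1 = (real j - real N) / N"
        using N0(1)[OF N] by (simp add: field_simps)
      ultimately show ?thesis by simp
    qed
    show ?thesis by (intro B_ge * N0(1)[OF N] that)
  qed
  have diff: "\<bar>(\<Sum>k<N. band_pow (r N) (a N) l k k) - (\<Sum>k<N. band_pow (r N) (corner N (a N)) l k k)\<bar> \<le> D N"
    if N: "N \<ge> N0" for N
    unfolding D_def
    by (rule sum_band_pow_corner_diff_le[OF window[OF N] B_nonneg[OF N0(1)[OF N]] N0(3)[OF N]]) auto
  have fluct: "AE \<omega> in PiM {1..} (\<lambda>N. ensemble_measure N (\<mu> N) (P N) (Q N)).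
    (\<lambda>N. banded_ensemble.fluctuation N (\<mu> N) (P N) (Q N) (r N) l (\<omega> N)) \<longlonglongrightarrow> 0"
  proof (rule AE_PiM_tendsto_zero)
    fix N :: nat assume "N \<in> {1..}"
    then show "prob_space (ensemble_measure N (\<mu> N) (P N) (Q N))"
      using assms(1)[of N] by (simp add: biorthogonal_ensemble_def)
  next
    fix N assume N: "N \<ge> N0"
    note N1 = N0(1)[OF N]
    interpret banded_ensemble N "\<mu> N" "P N" "Q N" "r N" by (rule ens[OF N1])
    show "N \<in> {1..}" using N1 by simp
    show "fluctuation l \<in> borel_measurable \<P>" "integrable \<P> (\<lambda>x. (fluctuation l x)\<^sup>2)"
      by (rule fluctuation_moments)+
    have "variance (\<lambda>x. \<Sum>i<N. x i ^ l) \<le> V N"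
      unfolding variance_power_sum entry[OF N1] V_def
      by (rule order_trans[OF abs_ge_self sum_band_pow_double_diff_le[OF window[OF N] B_nonneg[OF N1] N0(3)[OF N]]]) auto
    also have "\<dots> \<le> real N powr (1 / 2)"
      by (rule N0(4)[OF N])
    finally have "(\<integral>x. (fluctuation l x)\<^sup>2 \<partial>\<P>) \<le> real N powr (1 / 2) / N\<^sup>2"
      unfolding fluctuation_moments(3) by (intro divide_right_mono) auto
    \<comment> \<open>The exponent only has to stay below -1 for the series to converge.\<close>
    also have "\<dots> = real N powr (- 3 / 2)"
      using N1 by (simp add: powr_numeral[symmetric] powr_diff[symmetric] del: powr_numeral)
    finally show "(\<integral>x. (fluctuation l x)\<^sup>2 \<partial>\<P>) \<le> real N powr (- 3 / 2)" .
  next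
    show "summable (\<lambda>N. real N powr (- 3 / 2))"
      by (simp add: summable_real_powr_iff)
  qed
  have D_lim: "(\<lambda>N. D N / N) \<longlonglongrightarrow> 0"
    using smalloD_tendsto[OF subpolynomialD[OF D, of 1]] by simp
  from fluct show ?thesis
  proof eventually_elim
    case (elim \<omega>)
    have "(\<lambda>N. \<bar>banded_ensemble.fluctuation N (\<mu> N) (P N) (Q N) (r N) l (\<omega> N)\<bar> + D N / N) \<longlonglongrightarrow> 0"
      using tendsto_add[OF tendsto_rabs[OF elim] D_lim] by simp
    then show ?case
    proof (rule Lim_null_comparison[rotated])
      show "\<forall>\<^sub>F N in sequentially. norm (cmod (complex_of_real (\<integral>x. x ^ l \<partial>empirical_measure N (\<omega> N))
             - (\<integral>z. z ^ l \<partial>zero_measure N (ensemble_measure N (\<mu> N) (P N) (Q N))))) \<le>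
          \<bar>banded_ensemble.fluctuation N (\<mu> N) (P N) (Q N) (r N) l (\<omega> N)\<bar> + D N / N"
        using eventually_ge_at_top[of N0]
      proof eventually_elim
        case (elim N)
        note N1 = N0(1)[OF elim]
        show ?case
          using banded_ensemble.cmod_empirical_minus_zero_le[OF ens[OF N1] N1, where l = l and x = "\<omega> N"]
            divide_right_mono[OF diff[OF elim], of "real N"]
          by (simp add: entry[OF N1])
      qed
    qed
  qed
qed

end
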